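(* Let $\Omega\subset\mathbb{R}^n$ be a bounded domain with Lipschitz continuous boundary, let $\eta>0$ be a constant, and let $u_0\in D(\partial\mathrm{TV})$ and $v_0\in D(\partial \mathrm{TV})\cap L^2(\Omega)$. Let $u$ be the weak solution of the damped second-order total variation flow $$\begin{cases}\ddot u(t)+\eta\dot u(t)-\operatorname{div}\left(\frac{\nabla u(t)}{|\nabla u(t)|}\right)=0 & \text{in }\Omega\times(0,\infty),\\ u(0)=u_0,\quad \dot u(0)=v_0 & \text{in }\Omega,\\ \partial_\nu u(t)=0 & \text{on }\partial\Omega\times(0,\infty).\end{cases}$$ Then $$\mathrm{TV}(u(t))=o\left(\frac1t\right)\quad\text{as } t\to\infty.$$
   Context: For $u\in L^1(\Omega)$ put $\|Du\|:=\sup\{\int_\Omega u\operatorname{div}\mathbf v\,dx:\ \mathbf v\in C_0^\infty(\Omega;\mathbb{R}^n),\ |\mathbf v(x)|\le 1\ \forall x\in\Omega\}$, and $BV(\Omega):=\{u\in L^1(\Omega):\|u\|_{L^1}+\|Du\|<\infty\}$. The total variation functional $\mathrm{TV}:L^2(\Omega)\to[0,\infty]$ is $\mathrm{TV}(u)=\|Du\|$ if $u\in L^2(\Omega)\cap BV(\Omega)$ and $\mathrm{TV}(u)=\infty$ if $u\in L^2(\Omega)\setminus BV(\Omega)$. $\partial\mathrm{TV}$ is its subdifferential in the Hilbert space $L^2(\Omega)$, and $D(\partial\mathrm{TV})=\{u\in L^2(\Omega):\partial\mathrm{TV}(u)\neq\emptyset\}$. The expression $-\operatorname{div}(\nabla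 u/|\nabla u|)$ formally denotes an element of $\partial\mathrm{TV}(u)$. Dots denote time derivatives, with values in $L^2(\Omega)$. A weak solution is a function $u\in L^\infty([0,\infty);D(\partial\mathrm{TV}))\cap W_2^\infty([0,\infty);L^2(\Omega))$ with $u(0)=u_0$, $\dot u(0)=v_0$ and $\ddot u(t)+\eta\dot u(t)+\partial\mathrm{TV}(u(t))\ni 0$ for almost every $t\ge0$. Here $W_2^\infty([0,\infty);L^2(\Omega))$ is the space of $u$ with $u,\dot u,\ddot u\in L^\infty([0,\infty);L^2(\Omega))$, and $L^\infty([0,\infty);D(\partial\mathrm{TV}))$ is the set of $u\in L^\infty([0,\infty);L^2(\Omega))$ with $u(t)\in D(\partial\mathrm{TV})$ for almost every $t$. The Neumann condition ($\nu$ the outward unit normal on $\partial\Omega$) is understood in the weak sense encoded in the subdifferential $\partial\mathrm{TV}$ on $L^2(\Omega)$. *)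

theory Defs
  imports "HOL-Analysis.Analysis" "HOL-Library.Landau_Symbols"
begin

section \<open>The Hilbert space of square integrable functions\<close>

text \<open>
  Real-valued, Lebesgue measurable, square integrable functions on a Euclidean space,
  identified when they agree almost everywhere, form a separable Hilbert space.
  The space over a subset of the Euclidean space is obtained below as a closed subspace.
\<close>

definition square_integrable :: "('a::euclidean_space \<Rightarrow> real) \<Rightarrow> bool"
  where "square_integrable f \<longleftrightarrow>
    f \<in> borel_measurable lebesgue \<and> integrable lebesgue (\<lambda>x. (f x)\<^sup>2)"

lemma square_integrable_measurable [measurable_dest]:
  "square_integrable f \<Longrightarrow> f \<in> borel_measurable lebesgue"
  by (simp add: square_integrable_def)

lemma square_integrable_mult:
  assumes "square_integrable f" "square_integrable g"
  shows "integrable lebesgue (\<lambda>x. f x * g x)"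
proof (rule Bochner_Integration.integrable_bound)
  show "integrable lebesgue (\<lambda>x. (f x)\<^sup>2 + (g x)\<^sup>2)"
    using assms by (auto simp: square_integrable_def)
  show "(\<lambda>x. f x * g x) \<in> borel_measurable lebesgue"
    using assms by (auto simp: square_integrable_def)
  have "\<bar>a * b\<bar> \<le> \<bar>a\<^sup>2 + b\<^sup>2\<bar>" for a b :: real
  proof -
    have "2 * \<bar>a\<bar> * \<bar>b\<bar> \<le> a\<^sup>2 + b\<^sup>2" using sum_squares_bound[of "\<bar>a\<bar>" "\<bar>b\<bar>"] by simp
    moreover have "0 \<le> \<bar>a\<bar> * \<bar>b\<bar>" by simp
    ultimately show ?thesis unfolding abs_mult by linarith
  qed
  then show "AE x in lebesgue. norm (f x * g x) \<le> norm ((f x)\<^sup>2 + (g x)\<^sup>2)" by simp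
qed

lemma square_integrable_add:
  assumes f: "square_integrable f" and g: "square_integrable g"
  shows "square_integrable (\<lambda>x. f x + g x)"
proof -
  have "integrable lebesgue (\<lambda>x. (f x)\<^sup>2 + (g x)\<^sup>2 + 2 * (f x * g x))"
    using assms square_integrable_mult[OF f g]
    by (intro Bochner_Integration.integrable_add) (auto simp: square_integrable_def)
  moreover have "(\<lambda>x. (f x + g x)\<^sup>2) = (\<lambda>x. (f x)\<^sup>2 + (g x)\<^sup>2 + 2 * (f x * g x))"
    by (auto simp: power2_sum)
  ultimately show ?thesis using assms by (auto simp: square_integrable_def)
qed

lemma square_integrable_scale:
  "square_integrable f \<Longrightarrow> square_integrable (\<lambda>x. c * f x)"
  by (auto simp: square_integrable_def power_mult_distrib)

lemma square_integrable_uminus: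
  "square_integrable f \<Longrightarrow> square_integrable (\<lambda>x. - f x)"
  by (auto simp: square_integrable_def)

lemma square_integrable_diff:
  "square_integrable f \<Longrightarrow> square_integrable g \<Longrightarrow> square_integrable (\<lambda>x. f x - g x)"
  using square_integrable_add[OF _ square_integrable_uminus[of g]] by simp

lemma square_integrable_zero: "square_integrable (\<lambda>x. 0)"
  by (simp add: square_integrable_def)

quotient_type (overloaded) 'a L2 = "'a::euclidean_space \<Rightarrow> real" /
  partial: "\<lambda>f g. square_integrable f \<and> square_integrable g \<and> (AE x in lebesgue. f x = g x)"
proof (rule part_equivpI)
  show "\<exists>f::'a \<Rightarrow> real. square_integrable f \<and> square_integrable f \<and> (AE x in lebesgue. f x = f x)"
    using square_integrable_zero by auto
qed (auto intro!: sympI transpI elim: AE_mp)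

instantiation L2 :: (euclidean_space) real_vector
begin

lift_definition zero_L2 :: "'a L2" is "\<lambda>x. 0" by (simp add: square_integrable_zero)

lift_definition plus_L2 :: "'a L2 \<Rightarrow> 'a L2 \<Rightarrow> 'a L2" is "\<lambda>f g x. f x + g x"
  by (auto intro: square_integrable_add)

lift_definition uminus_L2 :: "'a L2 \<Rightarrow> 'a L2" is "\<lambda>f x. - f x"
  by (auto intro: square_integrable_uminus)

lift_definition minus_L2 :: "'a L2 \<Rightarrow> 'a L2 \<Rightarrow> 'a L2" is "\<lambda>f g x. f x - g x"
  by (auto intro: square_integrable_diff)

lift_definition scaleR_L2 :: "real \<Rightarrow> 'a L2 \<Rightarrow> 'a L2" is "\<lambda>c f x. c * f x"
  by (auto intro: square_integrable_scale)

instance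
proof
  fix f g h :: "'a L2" and r s :: real
  show "f + g + h = f + (g + h)"
    by transfer (auto simp: add.assoc intro: square_integrable_add)
  show "f + g = g + f"
    by transfer (auto simp: add.commute intro: square_integrable_add)
  show "0 + f = f"
    by transfer auto
  show "- f + f = 0"
    by transfer (auto simp: square_integrable_zero)
  show "f - g = f + - g"
    by transfer (auto intro: square_integrable_diff)
  show "r *\<^sub>R (f + g) = r *\<^sub>R f + r *\<^sub>R g"
    by transfer (auto simp: algebra_simps intro: square_integrable_add square_integrable_scale)
  show "(r + s) *\<^sub>R f = r *\<^sub>R f + s *\<^sub>R f"
    by transfer (auto simp: algebra_simps intro: square_integrable_add square_integrable_scale)
  show "r *\<^sub>R s *\<^sub>R f = (r * s) *\<^sub>R f"
    by transfer (auto simp: algebra_simps intro: square_integrable_scale)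
  show "1 *\<^sub>R f = f"
    by transfer auto
qed

end

instantiation L2 :: (euclidean_space) real_inner
begin

lift_definition inner_L2 :: "'a L2 \<Rightarrow> 'a L2 \<Rightarrow> real" is "\<lambda>f g. LINT x|lebesgue. f x * g x"
  by (rule integral_cong_AE) (auto simp: square_integrable_def)

definition norm_L2 :: "'a L2 \<Rightarrow> real" where "norm_L2 f = sqrt (f \<bullet> f)"
definition dist_L2 :: "'a L2 \<Rightarrow> 'a L2 \<Rightarrow> real" where "dist_L2 f g = norm (f - g)"
definition sgn_L2 :: "'a L2 \<Rightarrow> 'a L2" where "sgn_L2 f = inverse (norm f) *\<^sub>R f"
definition uniformity_L2 :: "('a L2 \<times> 'a L2) filter"
  where "uniformity_L2 = (INF e\<in>{0<..}. principal {(f, g). dist f g < e})"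
definition open_L2 :: "'a L2 set \<Rightarrow> bool"
  where "open_L2 U \<longleftrightarrow> (\<forall>f\<in>U. eventually (\<lambda>(f', g). f' = f \<longrightarrow> g \<in> U) uniformity)"

instance
proof
  fix f g h :: "'a L2" and r s :: real
  show "dist f g = norm (f - g)" by (rule dist_L2_def)
  show "sgn f = f /\<^sub>R norm f" by (rule sgn_L2_def)
  show "uniformity = (INF e\<in>{0<..}. principal {(f, g::'a L2). dist f g < e})"
    by (rule uniformity_L2_def)
  show "open U \<longleftrightarrow> (\<forall>f\<in>U. eventually (\<lambda>(f', g). f' = f \<longrightarrow> g \<in> U) uniformity)" for U :: "'a L2 set"
    by (rule open_L2_def)
  show "f \<bullet> g = g \<bullet> f"
    by transfer (auto simp: mult.commute)
  show "(f + g) \<bullet> h = f \<bullet> h + g \<bullet> h"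
    by transfer (auto simp: distrib_right square_integrable_mult)
  show "r *\<^sub>R f \<bullet> g = r * (f \<bullet> g)"
    by transfer (auto simp: mult.assoc)
  show "0 \<le> f \<bullet> f"
    by transfer auto
  show "f \<bullet> f = 0 \<longleftrightarrow> f = 0"
  proof transfer
    fix f :: "'a \<Rightarrow> real"
    assume f: "square_integrable f \<and> square_integrable f \<and> (AE x in lebesgue. f x = f x)"
    then show "(LINT x|lebesgue. f x * f x) = 0 \<longleftrightarrow>
        square_integrable f \<and> square_integrable (\<lambda>x::'a. 0) \<and> (AE x in lebesgue. f x = 0)"
      using integral_nonneg_eq_0_iff_AE[of lebesgue "\<lambda>x. f x * f x"] square_integrable_mult[of f f]
      by (auto simp: square_integrable_zero)
  qed
  show "norm f = sqrt (f \<bullet> f)" by (rule norm_L2_def)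
qed

end

lemma rep_L2_square_integrable: "square_integrable (rep_L2 f)"
  using Quotient_rep_reflp[OF Quotient_L2, of f] by simp

lemma abs_L2_eq_iff:
  assumes "square_integrable f" "square_integrable g"
  shows "abs_L2 f = abs_L2 g \<longleftrightarrow> (AE x in lebesgue. f x = g x)"
  using Quotient_rel[OF Quotient_L2, of f g] assms by simp

lemma rep_abs_L2:
  assumes "square_integrable f"
  shows "AE x in lebesgue. rep_L2 (abs_L2 f) x = f x"
  using Quotient_rep_abs[OF Quotient_L2, of f] assms by simp

lemma abs_rep_L2 [simp]: "abs_L2 (rep_L2 f) = f"
  by (rule Quotient_abs_rep[OF Quotient_L2])

lemma L2_diff_abs:
  assumes "square_integrable f" "square_integrable g"
  shows "abs_L2 f - abs_L2 g = abs_L2 (\<lambda>x. f x - g x)"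
  using assms by (simp add: minus_L2.abs_eq)

lemma norm_abs_L2:
  assumes "square_integrable f"
  shows "(norm (abs_L2 f))\<^sup>2 = (LINT x|lebesgue. (f x)\<^sup>2)"
  using assms by (simp add: power2_norm_eq_inner inner_L2.abs_eq) (simp add: power2_eq_square)

lemma norm_L2_nn:
  assumes "square_integrable f"
  shows "ennreal ((norm (abs_L2 f))\<^sup>2) = (\<integral>\<^sup>+x. ennreal ((f x)\<^sup>2) \<partial>lebesgue)"
  using assms by (simp add: norm_abs_L2 nn_integral_eq_integral square_integrable_def)

lemma tendsto_abs_L2_dominated:
  fixes f :: "'a::euclidean_space \<Rightarrow> real"
  assumes f: "square_integrable f" and s: "\<And>n. s n \<in> borel_measurable lebesgue"
    and w: "square_integrable w"
    and lim: "AE x in lebesgue. (\<lambda>n. s n x) \<longlonglongrightarrow> f x"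
    and bound: "\<And>n. AE x in lebesgue. \<bar>s n x\<bar> \<le> w x"
  shows "square_integrable (s n)" and "(\<lambda>n. abs_L2 (s n)) \<longlonglongrightarrow> abs_L2 f"
proof -
  have sq: "square_integrable (s n)" for n
    unfolding square_integrable_def
  proof
    show "integrable lebesgue (\<lambda>x. (s n x)\<^sup>2)"
    proof (rule Bochner_Integration.integrable_bound)
      show "integrable lebesgue (\<lambda>x. (w x)\<^sup>2)" using w by (simp add: square_integrable_def)
      show "AE x in lebesgue. norm ((s n x)\<^sup>2) \<le> norm ((w x)\<^sup>2)"
        using bound[of n] by eventually_elim (auto simp: abs_le_square_iff[symmetric])
    qed (use s in measurable)
  qed (rule s)
  then show "square_integrable (s n)" .
  have fw: "AE x in lebesgue. \<bar>f x\<bar> \<le> w x"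
  proof -
    have "AE x in lebesgue. \<forall>n. \<bar>s n x\<bar> \<le> w x" using bound by (simp add: AE_all_countable)
    then show ?thesis using lim
    proof eventually_elim
      case (elim x)
      show ?case
        by (rule tendsto_upperbound[OF tendsto_rabs[OF elim(2)]]) (use elim in auto)
    qed
  qed
  have "(\<lambda>n. LINT x|lebesgue. (s n x - f x)\<^sup>2) \<longlonglongrightarrow> (LINT x|(lebesgue :: 'a measure). 0)"
  proof (rule integral_dominated_convergence[where f="\<lambda>_. 0" and w="\<lambda>x. (2 * w x)\<^sup>2"])
    show "integrable lebesgue (\<lambda>x. (2 * w x)\<^sup>2)"
      using w by (auto simp: square_integrable_def power_mult_distrib)
    show "AE x in lebesgue. (\<lambda>n. (s n x - f x)\<^sup>2) \<longlonglongrightarrow> 0"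
      using lim
    proof eventually_elim
      case (elim x)
      have "(\<lambda>n. (s n x - f x)\<^sup>2) \<longlonglongrightarrow> (f x - f x)\<^sup>2" by (intro tendsto_intros elim)
      then show ?case by simp
    qed
    show "AE x in lebesgue. norm ((s n x - f x)\<^sup>2) \<le> (2 * w x)\<^sup>2" for n
      using bound[of n] fw
    proof eventually_elim
      case (elim x)
      then have "\<bar>s n x - f x\<bar> \<le> \<bar>2 * w x\<bar>" by linarith
      then show ?case unfolding abs_le_square_iff by simp
    qed
    show "(\<lambda>x. (s n x - f x)\<^sup>2) \<in> borel_measurable lebesgue" for n
      using s f by (auto simp: square_integrable_def)
  qed simp
  then have "(\<lambda>n. (norm (abs_L2 (s n) - abs_L2 f))\<^sup>2) \<longlonglongrightarrow> 0"
    using sq f by (simp add: L2_diff_abs norm_abs_L2 square_integrable_diff)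
  then have "(\<lambda>n. sqrt ((norm (abs_L2 (s n) - abs_L2 f))\<^sup>2)) \<longlonglongrightarrow> sqrt 0"
    by (rule tendsto_real_sqrt)
  then show "(\<lambda>n. abs_L2 (s n)) \<longlonglongrightarrow> abs_L2 f"
    by (simp add: tendsto_norm_zero_iff LIM_zero_iff)
qed

instance L2 :: (euclidean_space) banach
proof
  fix X :: "nat \<Rightarrow> 'a L2"
  assume "Cauchy X"
  then have *: "\<forall>n. \<exists>N. \<forall>k\<ge>N. \<forall>m\<ge>N. norm (X k - X m) < (1/2)^n"
    by (auto simp: Cauchy_def dist_norm)
  then obtain N where N: "\<And>n k m. N n \<le> k \<Longrightarrow> N n \<le> m \<Longrightarrow> norm (X k - X m) < (1/2)^n"
    by metis
  define r where "r n = (\<Sum>i\<le>n. N i) + n" for n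
  have Nr: "N n \<le> r m" if "n \<le> m" for n m
  proof -
    have "N n \<le> (\<Sum>i\<le>m. N i)" using that by (intro member_le_sum) auto
    then show ?thesis by (simp add: r_def)
  qed
  define f where "f n = rep_L2 (X (r n))" for n
  have f: "square_integrable (f n)" for n by (simp add: f_def rep_L2_square_integrable)
  have f_meas [measurable]: "f n \<in> borel_measurable lebesgue" for n
    using f by (simp add: square_integrable_def)
  have absf: "abs_L2 (f n) = X (r n)" for n by (simp add: f_def)
  define h where "h n = (\<lambda>x. \<bar>f (Suc n) x - f n x\<bar>)" for n
  have h: "square_integrable (h n)" for n
    using square_integrable_diff[OF f[of "Suc n"] f[of n]]
    by (auto simp: h_def square_integrable_def)
  have normh: "norm (abs_L2 (h n)) \<le> (1/2)^n" for n
  proof -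
    have "(norm (abs_L2 (h n)))\<^sup>2 = (norm (X (r (Suc n)) - X (r n)))\<^sup>2"
      using f h by (simp add: norm_abs_L2 absf[symmetric] L2_diff_abs square_integrable_diff)
         (simp add: h_def)
    then have "norm (abs_L2 (h n)) = norm (X (r (Suc n)) - X (r n))" by simp
    then show ?thesis using N[OF Nr Nr, of n "Suc n" n] by simp
  qed
  define g where "g n = (\<lambda>x. \<Sum>i<n. h i x)" for n
  have g: "square_integrable (g n) \<and> norm (abs_L2 (g n)) \<le> (\<Sum>i<n. (1/2)^i)" for n
  proof (induction n)
    case 0
    have "abs_L2 (\<lambda>x. 0) = (0 :: 'a L2)" by (simp add: zero_L2.abs_eq)
    then show ?case by (simp add: g_def square_integrable_zero)
  next
    case (Suc n)
    have eq: "g (Suc n) = (\<lambda>x. g n x + h n x)" by (simp add: g_def)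
    have "abs_L2 (g (Suc n)) = abs_L2 (g n) + abs_L2 (h n)"
      unfolding eq using Suc h by (simp add: plus_L2.abs_eq)
    then have "norm (abs_L2 (g (Suc n))) \<le> norm (abs_L2 (g n)) + norm (abs_L2 (h n))"
      by (simp add: norm_triangle_ineq)
    with Suc normh[of n] show ?case
      using Suc h by (auto simp: eq intro: square_integrable_add)
  qed
  have geo: "(\<Sum>i<n. (1/2)^i) \<le> (2::real)" for n
    by (simp add: sum_gp_strict)
  have g_meas [measurable]: "g n \<in> borel_measurable lebesgue" for n
    using g by (simp add: square_integrable_def)
  have h0: "0 \<le> h n x" for n x by (simp add: h_def)
  have g0: "0 \<le> g n x" for n x by (simp add: g_def h0 sum_nonneg)
  have gmono: "g m x \<le> g n x" if "m \<le> n" for m n x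
    unfolding g_def using that by (intro sum_mono2) (auto simp: h0)
  have "(\<integral>\<^sup>+x. (SUP n. ennreal ((g n x)\<^sup>2)) \<partial>lebesgue) = (SUP n. \<integral>\<^sup>+x. ennreal ((g n x)\<^sup>2) \<partial>lebesgue)"
    by (rule nn_integral_monotone_convergence_SUP)
       (auto simp: incseq_def le_fun_def intro!: ennreal_leI power_mono gmono g0)
  also have "\<dots> \<le> ennreal 4"
  proof (rule SUP_least)
    fix n
    have "(norm (abs_L2 (g n)))\<^sup>2 \<le> 2\<^sup>2"
      using g[of n] geo[of n] by (intro power_mono) auto
    then show "(\<integral>\<^sup>+x. ennreal ((g n x)\<^sup>2) \<partial>lebesgue) \<le> ennreal 4"
      using g[of n] by (simp add: norm_L2_nn[symmetric] del: ennreal_numeral)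
  qed
  finally have "AE x in lebesgue. (SUP n. ennreal ((g n x)\<^sup>2)) \<noteq> \<infinity>"
    by (intro nn_integral_PInf_AE) (auto simp: top_unique)
  then have conv: "AE x in lebesgue. convergent (\<lambda>n. f n x)"
  proof eventually_elim
    case (elim x)
    then obtain c where c: "0 \<le> c" "(SUP n. ennreal ((g n x)\<^sup>2)) = ennreal c"
      by (metis ennreal_cases infinity_ennreal_def)
    have "(g n x)\<^sup>2 \<le> c" for n
    proof -
      have "ennreal ((g n x)\<^sup>2) \<le> ennreal c" unfolding c(2)[symmetric] by (rule SUP_upper) simp
      then show ?thesis using c(1) by simp
    qed
    then have "g n x \<le> sqrt c" for n by (simp add: real_le_rsqrt)
    then have "summable (\<lambda>n. h n x)"
      by (intro summableI_nonneg_bounded[where x="sqrt c"]) (auto simp: h0 g_def)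
    then have "summable (\<lambda>n. f (Suc n) x - f n x)"
      unfolding h_def by (rule summable_rabs_cancel)
    then have "convergent (\<lambda>n. \<Sum>i<n. f (Suc i) x - f i x)"
      by (simp add: summable_iff_convergent)
    then have "convergent (\<lambda>n. f n x - f 0 x)"
      by (simp add: sum_lessThan_telescope[of "\<lambda>i. f i x"])
    then have "convergent (\<lambda>n. (f n x - f 0 x) + f 0 x)"
      by (intro convergent_add convergent_const)
    then show ?case by simp
  qed
  define F where "F x = lim (\<lambda>n. f n x)" for x
  have F_meas [measurable]: "F \<in> borel_measurable lebesgue"
    unfolding F_def by measurable
  have lim: "AE x in lebesgue. (\<lambda>n. f n x) \<longlonglongrightarrow> F x"
    using conv by eventually_elim (simp add: F_def convergent_LIMSEQ_iff)
  have fatou: "(\<integral>\<^sup>+x. ennreal ((rep_L2 (X k) x - F x)\<^sup>2) \<partial>lebesgue) \<le> ennreal (((1/2)^n)\<^sup>2)" if "N n \<le> k" for k n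
  proof -
    have [measurable]: "rep_L2 (X k) \<in> borel_measurable lebesgue"
      using rep_L2_square_integrable[of "X k"] by (simp add: square_integrable_def)
    have "(\<integral>\<^sup>+x. ennreal ((rep_L2 (X k) x - F x)\<^sup>2) \<partial>lebesgue)
        = (\<integral>\<^sup>+x. liminf (\<lambda>m. ennreal ((rep_L2 (X k) x - f m x)\<^sup>2)) \<partial>lebesgue)"
    proof (rule nn_integral_cong_AE)
      show "AE x in lebesgue. ennreal ((rep_L2 (X k) x - F x)\<^sup>2) =
          liminf (\<lambda>m. ennreal ((rep_L2 (X k) x - f m x)\<^sup>2))"
        using lim
      proof eventually_elim
        case (elim x)
        have "(\<lambda>m. ennreal ((rep_L2 (X k) x - f m x)\<^sup>2)) \<longlonglongrightarrow> ennreal ((rep_L2 (X k) x - F x)\<^sup>2)"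
          by (intro tendsto_intros tendsto_ennrealI elim)
        then show ?case by (intro lim_imp_Liminf[symmetric]) simp_all
      qed
    qed
    also have "\<dots> \<le> liminf (\<lambda>m. \<integral>\<^sup>+x. ennreal ((rep_L2 (X k) x - f m x)\<^sup>2) \<partial>lebesgue)"
      by (rule nn_integral_liminf) measurable
    also have "\<dots> \<le> limsup (\<lambda>m. \<integral>\<^sup>+x. ennreal ((rep_L2 (X k) x - f m x)\<^sup>2) \<partial>lebesgue)"
      by (rule Liminf_le_Limsup) simp
    also have "\<dots> \<le> ennreal (((1/2)^n)\<^sup>2)"
    proof (rule Limsup_bounded)
      show "\<forall>\<^sub>F m in sequentially.
          (\<integral>\<^sup>+x. ennreal ((rep_L2 (X k) x - f m x)\<^sup>2) \<partial>lebesgue) \<le> ennreal (((1/2)^n)\<^sup>2)"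
        using eventually_ge_at_top[of n]
      proof eventually_elim
        case (elim m)
        have "X k - X (r m) = abs_L2 (\<lambda>x. rep_L2 (X k) x - f m x)"
          using L2_diff_abs[OF rep_L2_square_integrable f, of "X k" m] by (simp add: absf)
        then have "(\<integral>\<^sup>+x. ennreal ((rep_L2 (X k) x - f m x)\<^sup>2) \<partial>lebesgue) = ennreal ((norm (X k - X (r m)))\<^sup>2)"
          by (simp add: norm_L2_nn square_integrable_diff rep_L2_square_integrable f)
        also have "\<dots> \<le> ennreal (((1/2)^n)\<^sup>2)"
          using N[OF that Nr[OF elim]] by (intro ennreal_leI power_mono) auto
        finally show ?case .
      qed
    qed
    finally show ?thesis .
  qed
  have diff_sq: "square_integrable (\<lambda>x. rep_L2 (X k) x - F x)" if "N n \<le> k" for k n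
    unfolding square_integrable_def
  proof
    have [measurable]: "rep_L2 (X k) \<in> borel_measurable lebesgue"
      using rep_L2_square_integrable[of "X k"] by (simp add: square_integrable_def)
    show "(\<lambda>x. rep_L2 (X k) x - F x) \<in> borel_measurable lebesgue" by measurable
    show "integrable lebesgue (\<lambda>x. (rep_L2 (X k) x - F x)\<^sup>2)"
    proof (rule integrableI_nonneg)
      show "(\<integral>\<^sup>+x. ennreal ((rep_L2 (X k) x - F x)\<^sup>2) \<partial>lebesgue) < \<infinity>"
        using fatou[OF that] by (rule le_less_trans) simp
    qed auto
  qed
  have F: "square_integrable F"
    using square_integrable_diff[OF rep_L2_square_integrable diff_sq[of 0 "N 0"], of "X (N 0)"] by simp
  have est: "norm (X k - abs_L2 F) \<le> (1/2)^n" if "N n \<le> k" for k n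
  proof -
    have "X k - abs_L2 F = abs_L2 (\<lambda>x. rep_L2 (X k) x - F x)"
      using L2_diff_abs[OF rep_L2_square_integrable F, of "X k"] by simp
    then have "ennreal ((norm (X k - abs_L2 F))\<^sup>2) \<le> ennreal (((1/2)^n)\<^sup>2)"
      using fatou[OF that] diff_sq[OF that] by (simp add: norm_L2_nn)
    then have "(norm (X k - abs_L2 F))\<^sup>2 \<le> ((1/2)^n)\<^sup>2" by (simp del: power_mult)
    then show ?thesis by (rule power2_le_imp_le) simp
  qed
  have "X \<longlonglongrightarrow> abs_L2 F"
  proof (rule LIMSEQ_I)
    fix e :: real assume "0 < e"
    then obtain n where n: "(1/2::real)^n < e"
      using real_arch_pow_inv[of e "1/2"] by auto
    then show "\<exists>no. \<forall>k\<ge>no. norm (X k - abs_L2 F) < e"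
      using est[of n] by (intro exI[of _ "N n"]) force
  qed
  then show "convergent X" by (auto simp: convergent_def)
qed

lemma square_integrable_indicator:
  assumes "A \<in> sets borel" "bounded A"
  shows "square_integrable (indicator A :: 'a::euclidean_space \<Rightarrow> real)"
proof -
  have A: "A \<in> lmeasurable"
    using assms by (intro bounded_set_imp_lmeasurable) auto
  have "(\<lambda>x. (indicator A x)\<^sup>2 :: real) = indicator A"
    by (auto simp: indicator_def)
  moreover have "integrable lebesgue (indicator A :: 'a \<Rightarrow> real)"
    using A by (auto simp: fmeasurable_def)
  ultimately show ?thesis
    using A by (auto simp: square_integrable_def fmeasurable_def)
qed

lemma closed_subspace_L2_eq_UNIV:
  fixes S :: "'a::euclidean_space L2 set" and G :: "'a set set"
  assumes add: "\<And>f g. f \<in> S \<Longrightarrow> g \<in> S \<Longrightarrow> f + g \<in> S"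
    and scale: "\<And>c f. f \<in> S \<Longrightarrow> c *\<^sub>R f \<in> S" and "closed S"
    and G: "Int_stable G" "UNIV \<in> G" "borel = sigma UNIV G"
    and base: "\<And>A n. A \<in> G \<Longrightarrow> abs_L2 (indicator (A \<inter> ball 0 (real n))) \<in> S"
  shows "S = UNIV"
proof -
  let ?I = "\<lambda>A n. indicator (A \<inter> ball 0 (real n)) :: 'a \<Rightarrow> real"
  have zero: "0 \<in> S"
    using scale[OF base[OF G(2)], of 0] by simp
  have diff: "f - g \<in> S" if "f \<in> S" "g \<in> S" for f g
    using add[OF that(1) scale[OF that(2), of "-1"]] by simp
  have sq: "square_integrable (?I A n)" if "A \<in> sets borel" for A n
    using that by (intro square_integrable_indicator) auto
  have sum: "abs_L2 (\<lambda>x. \<Sum>i\<in>J. c i * f i x) \<in> S \<and> square_integrable (\<lambda>x. \<Sum>i\<in>J. c i * f i x)"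
    if "finite J" "\<And>i. i \<in> J \<Longrightarrow> square_integrable (f i)" "\<And>i. i \<in> J \<Longrightarrow> abs_L2 (f i) \<in> S"
    for J and c :: "'i \<Rightarrow> real" and f
    using that
  proof (induction J rule: finite_induct)
    case empty
    have "abs_L2 (\<lambda>x. 0) = (0 :: 'a L2)" by (simp add: zero_L2.abs_eq)
    then show ?case using zero by (simp add: square_integrable_zero)
  next
    case (insert j J)
    have *: "square_integrable (\<lambda>x. c j * f j x)" "square_integrable (\<lambda>x. \<Sum>i\<in>J. c i * f i x)"
      using insert by (auto intro: square_integrable_scale)
    have "abs_L2 (\<lambda>x. c j * f j x + (\<Sum>i\<in>J. c i * f i x))
        = c j *\<^sub>R abs_L2 (f j) + abs_L2 (\<lambda>x. \<Sum>i\<in>J. c i * f i x)"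
      using * insert by (simp add: plus_L2.abs_eq scaleR_L2.abs_eq)
    also have "\<dots> \<in> S" using insert by (intro add scale) auto
    finally show ?case
      using insert * by (simp add: square_integrable_add)
  qed
  have ind: "abs_L2 (?I A n) \<in> S" if "A \<in> sets borel" for A n
  proof -
    have eq: "sets borel = sigma_sets UNIV G" by (simp add: G(3))
    have Gpow: "G \<subseteq> Pow UNIV" by simp
    show ?thesis
      using G(1) Gpow that[unfolded eq]
    proof (induction rule: sigma_sets_induct_disjoint)
      case (basic A)
      then show ?case by (rule base)
    next
      case empty
      have "abs_L2 (\<lambda>x. 0) = (0 :: 'a L2)" by (simp add: zero_L2.abs_eq)
      moreover have "?I {} n = (\<lambda>x. 0)" by auto
      ultimately show ?case using zero by simp
    next
      case (compl A)
      have "?I (UNIV - A) n = (\<lambda>x. ?I UNIV n x - ?I A n x)"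
        by (auto simp: indicator_def)
      then have "abs_L2 (?I (UNIV - A) n) = abs_L2 (?I UNIV n) - abs_L2 (?I A n)"
        using L2_diff_abs[OF sq[of UNIV n] sq[of A n]] compl(1)[folded eq] by simp
      then show ?case using compl base[OF G(2)] by (auto intro: diff)
    next
      case (union A)
      then have A: "A i \<in> sets borel" for i using eq by auto
      have "(\<lambda>k. abs_L2 (\<lambda>x. \<Sum>i<k. 1 * ?I (A i) n x)) \<longlonglongrightarrow> abs_L2 (?I (\<Union>i. A i) n)"
      proof (rule tendsto_abs_L2_dominated)
        show "square_integrable (?I (\<Union>i. A i) n)" "square_integrable (?I UNIV n)"
          using A sq[of UNIV n] by (auto intro!: sq)
        show "(\<lambda>x. \<Sum>i<k. 1 * ?I (A i) n x) \<in> borel_measurable lebesgue" for k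
        proof -
          have [measurable]: "?I (A i) n \<in> borel_measurable lebesgue" for i
            using sq[OF A] by (simp add: square_integrable_def)
          show ?thesis by measurable
        qed
        have eq2: "(\<Sum>i<k. 1 * ?I (A i) n x) = ?I (\<Union>i<k. A i) n x" for k x
        proof -
          have "(\<Sum>i<k. indicator (A i) x) = (indicator (\<Union>i<k. A i) x :: real)"
            using union(1) by (intro indicator_UN_disjoint[symmetric])
               (auto simp: disjoint_family_on_def)
          then show ?thesis
            by (simp add: indicator_inter_arith sum_distrib_right[symmetric])
        qed
        show "AE x in lebesgue. \<bar>\<Sum>i<k. 1 * ?I (A i) n x\<bar> \<le> ?I UNIV n x" for k
          unfolding eq2 by (auto simp: indicator_def)
        have "(\<lambda>k. ?I (\<Union>i<k. A i) n x) \<longlonglongrightarrow> ?I (\<Union>i. A i) n x" for x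
        proof (rule tendsto_eventually)
          show "\<forall>\<^sub>F k in sequentially. ?I (\<Union>i<k. A i) n x = ?I (\<Union>i. A i) n x"
          proof (cases "x \<in> (\<Union>i. A i)")
            case True
            then obtain j where "x \<in> A j" by auto
            show ?thesis
              using eventually_gt_at_top[of j]
              by eventually_elim (use \<open>x \<in> A j\<close> in \<open>auto simp: indicator_def\<close>)
          qed (auto simp: indicator_def)
        qed
        then show "AE x in lebesgue. (\<lambda>k. \<Sum>i<k. 1 * ?I (A i) n x) \<longlonglongrightarrow> ?I (\<Union>i. A i) n x"
          unfolding eq2 by simp
      qed
      moreover have "abs_L2 (\<lambda>x. \<Sum>i<k. 1 * ?I (A i) n x) \<in> S" for k
        using sum[of "{..<k}" "\<lambda>i. ?I (A i) n" "\<lambda>_. 1"] sq[OF A] union(3) by auto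
      ultimately show ?case by (rule closed_sequentially[OF \<open>closed S\<close>, rotated])
    qed
  qed
  have "u \<in> S" for u
  proof -
    let ?f = "rep_L2 u"
    have f: "square_integrable ?f" by (rule rep_L2_square_integrable)
    obtain g where g: "g \<in> borel_measurable lborel" "AE x in lborel. ?f x = g x"
      using completion_ex_borel_measurable_real[of ?f lborel] f by (auto simp: square_integrable_def)
    have fg: "AE x in lebesgue. ?f x = g x" using g(2) by (rule AE_completion)
    have gm: "g \<in> borel_measurable lebesgue" using g(1) by (simp add: measurable_completion)
    have gsq: "square_integrable g"
      unfolding square_integrable_def
    proof
      show "integrable lebesgue (\<lambda>x. (g x)\<^sup>2)"
        using f fg gm
        by (subst integrable_cong_AE[where g="\<lambda>x. (?f x)\<^sup>2"]) (auto simp: square_integrable_def)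
    qed (rule gm)
    have u: "u = abs_L2 g"
      using abs_L2_eq_iff[OF f gsq] fg by simp
    obtain s where s: "\<And>i. simple_function lborel (s i)" "\<And>x. (\<lambda>i. s i x) \<longlonglongrightarrow> g x"
      "\<And>i x. \<bar>s i x\<bar> \<le> 2 * \<bar>g x\<bar>"
      using borel_measurable_implies_sequence_metric[OF g(1), of 0] by (auto simp: dist_real_def)
    define t where "t i = (\<lambda>x. \<Sum>y\<in>range (s i). y * ?I (s i -` {y}) i x)" for i
    have fin: "finite (range (s i))" for i
      using simple_functionD(1)[OF s(1)] by simp
    have meas: "s i -` {y} \<in> sets borel" for i y
      using simple_functionD(2)[OF s(1), of i "{y}"] by simp
    have tS: "abs_L2 (t i) \<in> S \<and> square_integrable (t i)" for i
      unfolding t_def using fin meas by (intro sum ind sq) auto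
    have t: "t i x = s i x * indicator (ball 0 (real i)) x" for i x
    proof -
      have "t i x = (\<Sum>y\<in>range (s i). if y = s i x then y * indicator (ball 0 (real i)) x else 0)"
        unfolding t_def by (intro sum.cong) (auto simp: indicator_def)
      then show ?thesis using fin by (simp add: sum.delta')
    qed
    have "(\<lambda>i. abs_L2 (t i)) \<longlonglongrightarrow> abs_L2 g"
    proof (rule tendsto_abs_L2_dominated[OF gsq])
      show "t i \<in> borel_measurable lebesgue" for i using tS by (simp add: square_integrable_def)
      have "square_integrable (\<lambda>x. \<bar>g x\<bar>)" using gsq by (auto simp: square_integrable_def)
      then show "square_integrable (\<lambda>x. 2 * \<bar>g x\<bar>)" by (rule square_integrable_scale)
      show "AE x in lebesgue. \<bar>t i x\<bar> \<le> 2 * \<bar>g x\<bar>" for i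
        using s(3) by (auto simp: t indicator_def)
      have "(\<lambda>i. t i x) \<longlonglongrightarrow> g x" for x
      proof (rule Lim_transform_eventually[OF s(2)])
        obtain N where "norm x < real N" using reals_Archimedean2 by blast
        show "\<forall>\<^sub>F i in sequentially. s i x = t i x"
          using eventually_ge_at_top[of N]
          by eventually_elim (use \<open>norm x < real N\<close> in \<open>auto simp: t indicator_def\<close>)
      qed
      then show "AE x in lebesgue. (\<lambda>i. t i x) \<longlonglongrightarrow> g x" by simp
    qed
    moreover have "abs_L2 (t i) \<in> S" for i using tS by blast
    ultimately show ?thesis
      unfolding u by (rule closed_sequentially[OF \<open>closed S\<close>, rotated])
  qed
  then show ?thesis by auto
qed

lemma countable_generator_borel:
  obtains G :: "'a::second_countable_topology set set"
  where "countable G" "Int_stable G" "UNIV \<in> G" "borel = sigma UNIV G"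
proof -
  obtain B :: "'a set set" where B: "countable B" "topological_basis B"
    using ex_countable_basis by blast
  define G where "G = Inter ` {F. finite F \<and> F \<subseteq> B}"
  show thesis
  proof
    show "countable G"
      unfolding G_def using countable_Collect_finite_subset[OF B(1)] by auto
    show "Int_stable G"
    proof (rule Int_stableI)
      fix X Y assume "X \<in> G" "Y \<in> G"
      then obtain F F' where "finite F" "F \<subseteq> B" "finite F'" "F' \<subseteq> B" "X = \<Inter>F" "Y = \<Inter>F'"
        by (auto simp: G_def)
      then show "X \<inter> Y \<in> G"
        unfolding G_def by (intro image_eqI[of _ _ "F \<union> F'"]) auto
    qed
    show "UNIV \<in> G" unfolding G_def by (intro image_eqI[of _ _ "{}"]) auto
    have "topological_basis G"
    proof (rule topological_basisI)
      show "open X" if "X \<in> G" for X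
        using that topological_basis_open[OF B(2)] by (auto simp: G_def intro!: open_Inter)
      fix O' x assume "open O'" "x \<in> (O' :: 'a set)"
      then obtain b where b: "b \<in> B" "x \<in> b" "b \<subseteq> O'"
        using topological_basisE[OF B(2)] by metis
      then have "b \<in> G" unfolding G_def by (intro image_eqI[of _ _ "{b}"]) auto
      with b show "\<exists>B'\<in>G. x \<in> B' \<and> B' \<subseteq> O'" by blast
    qed
    then show "borel = sigma UNIV G" by (rule borel_eq_countable_basis[OF \<open>countable G\<close>])
  qed
qed

lemma L2_separable: "\<exists>D :: 'a::euclidean_space L2 set. countable D \<and> closure D = UNIV"
proof -
  obtain G :: "'a set set" where G: "countable G" "Int_stable G" "UNIV \<in> G" "borel = sigma UNIV G"
    by (rule countable_generator_borel)
  define C :: "'a L2 set"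
    where "C = (\<lambda>(A, n). abs_L2 (indicator (A \<inter> ball 0 (real n)))) ` (G \<times> (UNIV :: nat set))"
  define comb where "comb = (\<lambda>xs. \<Sum>(q, c)\<leftarrow>xs. q *\<^sub>R (c :: 'a L2))"
  define D where "D = comb ` lists (\<rat> \<times> C)"
  have "countable C" unfolding C_def using G(1) by auto
  then have "countable D" unfolding D_def using countable_rat by auto
  have addD: "f + g \<in> D" if "f \<in> D" "g \<in> D" for f g
  proof -
    from that(1) obtain xs where xs: "f = comb xs" "xs \<in> lists (\<rat> \<times> C)"
      unfolding D_def by (rule imageE)
    from that(2) obtain ys where ys: "g = comb ys" "ys \<in> lists (\<rat> \<times> C)"
      unfolding D_def by (rule imageE)
    have "f + g = comb (xs @ ys)" using xs ys by (simp add: comb_def)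
    then show ?thesis unfolding D_def using xs ys by (intro image_eqI[of _ _ "xs @ ys"]) auto
  qed
  have scaleD: "q *\<^sub>R f \<in> D" if "q \<in> \<rat>" "f \<in> D" for q f
  proof -
    from that(2) obtain xs where xs: "f = comb xs" "xs \<in> lists (\<rat> \<times> C)"
      unfolding D_def by (rule imageE)
    let ?ys = "map (\<lambda>(p, c). (q * p, c)) xs"
    have "comb ?ys = q *\<^sub>R comb xs"
      by (induction xs) (auto simp: comb_def scaleR_add_right)
    moreover have "?ys \<in> lists (\<rat> \<times> C)" using xs(2) that(1) by (auto simp: in_lists_conv_set)
    ultimately show ?thesis unfolding D_def xs(1) by (intro image_eqI[of _ _ ?ys]) auto
  qed
  have "closure D = UNIV"
  proof (rule closed_subspace_L2_eq_UNIV[OF _ _ closed_closure G(2-4)])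
    show "f + g \<in> closure D" if "f \<in> closure D" "g \<in> closure D" for f g
    proof -
      from that(1) obtain a where *: "\<forall>n. a n \<in> D" "a \<longlonglongrightarrow> f"
        unfolding closure_sequential by auto
      from that(2) obtain b where "\<forall>n. b n \<in> D" "b \<longlonglongrightarrow> g"
        unfolding closure_sequential by auto
      with * show ?thesis
        unfolding closure_sequential
        by (intro exI[of _ "\<lambda>n. a n + b n"]) (auto intro: addD tendsto_add)
    qed
    show "c *\<^sub>R f \<in> closure D" if "f \<in> closure D" for c f
    proof -
      from that obtain a where a: "\<forall>n. a n \<in> D" "a \<longlonglongrightarrow> f"
        unfolding closure_sequential by auto
      have "\<forall>n. \<exists>q\<in>\<rat>. \<bar>q - c\<bar> < inverse (real (Suc n))"
      proof
        fix n
        obtain q where "q \<in> \<rat>" "c < q" "q < c + inverse (real (Suc n))"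
          using Rats_dense_in_real[of c "c + inverse (real (Suc n))"] by auto
        then show "\<exists>q\<in>\<rat>. \<bar>q - c\<bar> < inverse (real (Suc n))" by (intro bexI[of _ q]) auto
      qed
      then obtain q where q: "\<And>n. q n \<in> \<rat>" "\<And>n. \<bar>q n - c\<bar> < inverse (real (Suc n))"
        by metis
      have "(\<lambda>n. q n - c) \<longlonglongrightarrow> 0"
        by (rule Lim_null_comparison[OF _ LIMSEQ_inverse_real_of_nat])
           (use q(2) in \<open>auto intro!: always_eventually less_imp_le simp del: of_nat_Suc\<close>)
      then have "q \<longlonglongrightarrow> c" by (simp add: LIM_zero_iff)
      with a q show ?thesis
        unfolding closure_sequential
        by (intro exI[of _ "\<lambda>n. q n *\<^sub>R a n"]) (auto intro: scaleD tendsto_scaleR)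
    qed
    show "abs_L2 (indicator (A \<inter> ball 0 (real n))) \<in> closure D" if "A \<in> G" for A n
    proof -
      let ?c = "abs_L2 (indicator (A \<inter> ball 0 (real n))) :: 'a L2"
      have "?c \<in> C" unfolding C_def using that by auto
      then have "comb [(1, ?c)] \<in> D" unfolding D_def by (intro imageI) auto
      then have "?c \<in> D" by (simp add: comb_def)
      then show ?thesis using closure_subset by blast
    qed
  qed
  with \<open>countable D\<close> show ?thesis by blast
qed

instance L2 :: (euclidean_space) second_countable_topology
proof
  obtain D :: "'a L2 set" where D: "countable D" "closure D = UNIV"
    using L2_separable by blast
  define B where "B = (\<lambda>(d, n). ball d (inverse (real (Suc n)))) ` (D \<times> UNIV)"
  have "topological_basis B"
  proof (rule topological_basisI)
    show "open X" if "X \<in> B" for X using that by (auto simp: B_def)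
    fix U and f :: "'a L2" assume "open U" "f \<in> U"
    then obtain e where e: "0 < e" "ball f e \<subseteq> U" using open_contains_ball by blast
    obtain n where n: "inverse (real (Suc n)) < e / 2"
      using e(1) reals_Archimedean[of "e / 2"] by auto
    have "f \<in> closure D" using D(2) by simp
    then obtain d where d: "d \<in> D" "dist d f < inverse (real (Suc n))"
      unfolding closure_approachable by (meson inverse_positive_iff_positive of_nat_0_less_iff zero_less_Suc)
    have "ball d (inverse (real (Suc n))) \<subseteq> ball f e"
    proof
      fix g assume "g \<in> ball d (inverse (real (Suc n)))"
      then have "dist d g < inverse (real (Suc n))" by simp
      then show "g \<in> ball f e"
        using dist_triangle2[of f g d] d(2) n dist_triangle[of f g d]
        by (simp add: dist_commute)
    qed
    then show "\<exists>X\<in>B. f \<in> X \<and> X \<subseteq> U"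
      using d e(2) unfolding B_def
      by (intro bexI[of _ "ball d (inverse (real (Suc n)))"]) auto
  qed
  then show "\<exists>B::'a L2 set set. countable B \<and> open = generate_topology B"
    using D(1) topological_basis_imp_subbasis by (intro exI[of _ B]) (auto simp: B_def)
qed

section \<open>Function spaces over a domain\<close>

text \<open>
  Square integrable functions on \<open>\<Omega>\<close> are represented by their extension by zero, so that the
  inner product inherited from the whole space is the one over \<open>\<Omega>\<close>.
\<close>

definition L2_on :: "'a::euclidean_space set \<Rightarrow> 'a L2 set"
  where "L2_on \<Omega> = {u. AE x in lebesgue. x \<notin> \<Omega> \<longrightarrow> rep_L2 u x = 0}"

text \<open>
  Locally, after a rigid motion, \<open>\<Omega>\<close> is the strict epigraph of a Lipschitz function of the
  remaining \<open>n - 1\<close> variables, which are encoded as the hyperplane orthogonal to \<open>e\<close>.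
\<close>

definition lipschitz_boundary :: "'a::euclidean_space set \<Rightarrow> bool"
  where "lipschitz_boundary \<Omega> \<longleftrightarrow>
    (\<forall>p\<in>frontier \<Omega>. \<exists>r>0. \<exists>e \<gamma> L. norm e = 1 \<and> L-lipschitz_on {y. y \<bullet> e = 0} \<gamma> \<and>
      (\<forall>x\<in>ball p r. x \<in> \<Omega> \<longleftrightarrow> \<gamma> (x - (x \<bullet> e) *\<^sub>R e) < x \<bullet> e))"

definition bounded_lipschitz_domain :: "'a::euclidean_space set \<Rightarrow> bool"
  where "bounded_lipschitz_domain \<Omega> \<longleftrightarrow>
    open \<Omega> \<and> connected \<Omega> \<and> \<Omega> \<noteq> {} \<and> bounded \<Omega> \<and> lipschitz_boundary \<Omega>"

primrec C_k :: "nat \<Rightarrow> ('a::euclidean_space \<Rightarrow> 'b::real_normed_vector) \<Rightarrow> bool"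
  where
    "C_k 0 f \<longleftrightarrow> continuous_on UNIV f"
  | "C_k (Suc k) f \<longleftrightarrow>
      (\<forall>x. f differentiable (at x)) \<and> (\<forall>b\<in>Basis. C_k k (\<lambda>x. frechet_derivative f (at x) b))"

definition smooth :: "('a::euclidean_space \<Rightarrow> 'b::real_normed_vector) \<Rightarrow> bool"
  where "smooth f \<longleftrightarrow> (\<forall>k. C_k k f)"

text \<open>Test functions on \<open>U\<close> are taken on the whole space, extended by zero off \<open>U\<close>.\<close>

definition test_functions :: "'a::euclidean_space set \<Rightarrow> ('a \<Rightarrow> 'b::real_normed_vector) set"
  where "test_functions U =
    {\<phi>. smooth \<phi> \<and> (\<exists>K. compact K \<and> K \<subseteq> U \<and> (\<forall>x. x \<notin> K \<longrightarrow> \<phi> x = 0))}"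

section \<open>Total variation and its subdifferential\<close>

definition divergence :: "('a::euclidean_space \<Rightarrow> 'a) \<Rightarrow> 'a \<Rightarrow> real"
  where "divergence v x = (\<Sum>b\<in>Basis. frechet_derivative v (at x) b \<bullet> b)"

text \<open>\<open>variation \<Omega> u\<close> is \<open>\<parallel>Du\<parallel>\<close>; it is meaningful only for \<open>u\<close> integrable over \<open>\<Omega>\<close>.\<close>

definition variation :: "'a::euclidean_space set \<Rightarrow> ('a \<Rightarrow> real) \<Rightarrow> ereal"
  where "variation \<Omega> u =
    (SUP v\<in>{v \<in> test_functions \<Omega>. \<forall>x\<in>\<Omega>. norm (v x) \<le> 1}.
      ereal (LINT x:\<Omega>|lebesgue. u x * divergence v x))"

definition BV :: "'a::euclidean_space set \<Rightarrow> ('a \<Rightarrow> real) set"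
  where "BV \<Omega> = {u. set_integrable lebesgue \<Omega> u \<and>
    ereal (LINT x:\<Omega>|lebesgue. \<bar>u x\<bar>) + variation \<Omega> u < \<infinity>}"

definition TV :: "'a::euclidean_space set \<Rightarrow> 'a L2 \<Rightarrow> ereal"
  where "TV \<Omega> u = (if rep_L2 u \<in> BV \<Omega> then variation \<Omega> (rep_L2 u) else \<infinity>)"

definition subdifferential :: "'h::real_inner set \<Rightarrow> ('h \<Rightarrow> ereal) \<Rightarrow> 'h \<Rightarrow> 'h set"
  where "subdifferential H F u =
    {\<xi> \<in> H. u \<in> H \<and> F u < \<infinity> \<and> (\<forall>w\<in>H. F u + ereal (\<xi> \<bullet> (w - u)) \<le> F w)}"

definition dTV :: "'a::euclidean_space set \<Rightarrow> 'a L2 \<Rightarrow> 'a L2 set"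
  where "dTV \<Omega> = subdifferential (L2_on \<Omega>) (TV \<Omega>)"

definition dom_dTV :: "'a::euclidean_space set \<Rightarrow> 'a L2 set"
  where "dom_dTV \<Omega> = {u \<in> L2_on \<Omega>. dTV \<Omega> u \<noteq> {}}"

section \<open>Weak solutions of the damped second-order flow\<close>

text \<open>Essentially bounded, Bochner measurable functions on \<open>[0,\<infinity>)\<close> with values a.e. in \<open>X\<close>.\<close>

definition Linf_time :: "'h::{banach,second_countable_topology} set \<Rightarrow> (real \<Rightarrow> 'h) set"
  where "Linf_time X = {u. u \<in> borel_measurable (lebesgue_on {0..}) \<and>
    (AE t in lebesgue_on {0..}. u t \<in> X) \<and> (\<exists>C. AE t in lebesgue_on {0..}. norm (u t) \<le> C)}"

definition weak_time_derivative ::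
    "(real \<Rightarrow> 'h::{banach,second_countable_topology}) \<Rightarrow> (real \<Rightarrow> 'h) \<Rightarrow> bool"
  where "weak_time_derivative u u' \<longleftrightarrow> (\<forall>\<phi>::real \<Rightarrow> real. \<phi> \<in> test_functions {0<..} \<longrightarrow>
    (LINT t:{0<..}|lebesgue. deriv \<phi> t *\<^sub>R u t) = - (LINT t:{0<..}|lebesgue. \<phi> t *\<^sub>R u' t))"

text \<open>
  The existential quantifier provides the first and second weak derivatives \<open>u'\<close> and \<open>u''\<close>, so
  the membership of \<open>u\<close> in \<open>W\<^sub>2\<^sup>\<infinity>\<close> is spelled out. Elements of \<open>W\<^sub>2\<^sup>\<infinity>\<close> are classes modulo null
  sets of times; to give pointwise values such as \<open>u 0\<close>, \<open>u' 0\<close> and \<open>TV \<Omega> (u t)\<close> their meaning,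
  \<open>u\<close> and \<open>u'\<close> are the continuous representatives.
\<close>

definition weak_solution ::
    "'a::euclidean_space set \<Rightarrow> real \<Rightarrow> 'a L2 \<Rightarrow> 'a L2 \<Rightarrow> (real \<Rightarrow> 'a L2) \<Rightarrow> bool"
  where "weak_solution \<Omega> \<eta> u\<^sub>0 v\<^sub>0 u \<longleftrightarrow>
    u \<in> Linf_time (dom_dTV \<Omega>) \<and> continuous_on {0..} u \<and>
    (\<exists>u' u''. u' \<in> Linf_time (L2_on \<Omega>) \<and> u'' \<in> Linf_time (L2_on \<Omega>) \<and>
      weak_time_derivative u u' \<and> weak_time_derivative u' u'' \<and> continuous_on {0..} u' \<and>
      u 0 = u\<^sub>0 \<and> u' 0 = v\<^sub>0 \<and>
      (AE t in lebesgue_on {0..}. \<exists>\<xi>\<in>dTV \<Omega> (u t). u'' t + \<eta> *\<^sub>R u' t + \<xi> = 0))"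

end

theory Submission
  imports Defs
begin

text \<open>
  Write \<open>F = TV\<close> and let \<open>\<xi> = - u'' - \<eta> u'\<close> be the subgradient of \<open>F\<close> at \<open>u\<close> that the equation
  provides at almost every time. The idea is that the energy \<open>E = \<bar>u'\<bar>\<^sup>2 / 2 + F(u)\<close> is decreasing
  and integrable over \<open>[1, \<infinity>)\<close>; a decreasing integrable function is \<open>o(1 / t)\<close>
  (\<open>antimono_integral_bounded_smallo\<close>), and \<open>0 \<le> F(u) \<le> E\<close>.

  Two tests of the equation give this. Testing with \<open>u'\<close> gives \<open>E' \<le> - \<eta> \<bar>u'\<bar>\<^sup>2\<close>
  (\<open>E_dissipation\<close>), so \<open>E\<close> decreases and \<open>\<bar>u'\<bar>\<^sup>2\<close> is integrable. Testing with \<open>u\<close>, and using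
  \<open>F(u) \<le> \<xi> \<bullet> u\<close> since \<open>F\<close> vanishes at \<open>0\<close>, gives
  \<open>F(u) \<le> \<bar>u'\<bar>\<^sup>2 - (u \<bullet> u')' - \<eta> (\<bar>u\<bar>\<^sup>2 / 2)'\<close>; the derivatives integrate to bounded boundary
  terms because \<open>u\<close> and \<open>u'\<close> are bounded (\<open>\<phi>_integral_le\<close>). Hence \<open>F(u)\<close> is integrable too.

  The rest justifies this calculus at the available regularity. Weak derivatives in time are
  converted into the fundamental theorem of calculus (\<open>weak_time_derivative_imp_integral\<close>), and
  derivatives of products are only used in integrated form (\<open>inner_product_rule\<close>). For \<open>F(u)\<close>, the
  bounded subgradients at almost every time, together with lower semicontinuity, make \<open>t \<mapsto> F(u(t))\<close>
  finite and Lipschitz continuous (\<open>\<phi>_lipschitz\<close>), and the inequality in the chain rule that is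
  needed comes from integrated difference quotients (\<open>\<phi>_chain\<close>). Lower semicontinuity of \<open>TV\<close>
  holds because it is a supremum of inner products (\<open>TV_eq_SUP_inner\<close>).
\<close>

section \<open>A smooth step function on the real line\<close>

text \<open>
  For functions of one real variable, the partial derivatives in the definition of \<open>C_k\<close> are the
  ordinary derivative. This introduction rule and the following elimination rule let one prove
  smoothness by induction on \<open>k\<close> for families of functions that are closed under differentiation.
\<close>

lemma C_k_SucI:
  fixes f :: "real \<Rightarrow> real"
  assumes "\<And>x. (f has_real_derivative f' x) (at x)" and "C_k k f'"
  shows "C_k (Suc k) f"
proof -
  have "frechet_derivative f (at x) 1 = f' x" for x
    using frechet_derivative_at[OF has_field_derivative_imp_has_derivative[OF assms(1)[of x]]]
    by (metis mult.right_neutral)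
  moreover have "f differentiable (at x)" for x
    using assms(1)[of x] by (auto simp: real_differentiable_def)
  ultimately show ?thesis using assms(2) by simp
qed

lemma C_k_SucE:
  fixes f :: "real \<Rightarrow> real"
  assumes "C_k (Suc k) f"
  shows "(f has_real_derivative deriv f x) (at x)" and "C_k k (deriv f)"
proof -
  have d: "(f has_real_derivative deriv f x) (at x)" for x
    using assms by (simp add: DERIV_deriv_iff_real_differentiable)
  then show "(f has_real_derivative deriv f x) (at x)" .
  have "frechet_derivative f (at x) 1 = deriv f x" for x
    using frechet_derivative_at[OF has_field_derivative_imp_has_derivative[OF d[of x]]]
    by (metis mult.right_neutral)
  then show "C_k k (deriv f)" using assms by simp
qed

lemma C_k_Suc_imp: "C_k (Suc k) f \<Longrightarrow> C_k k (f :: real \<Rightarrow> real)"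
proof (induction k arbitrary: f)
  case 0
  then show ?case
    using C_k_SucE(1)[OF 0] by (auto intro!: continuous_at_imp_continuous_on DERIV_isCont)
next
  case (Suc k)
  show ?case
    by (rule C_k_SucI[OF C_k_SucE(1)[OF Suc.prems] Suc.IH[OF C_k_SucE(2)[OF Suc.prems]]])
qed

lemma C_k_add:
  "C_k k f \<Longrightarrow> C_k k g \<Longrightarrow> C_k k (\<lambda>x. f x + g x)" for f g :: "real \<Rightarrow> real"
proof (induction k arbitrary: f g)
  case 0
  then show ?case by (auto intro: continuous_on_add)
next
  case (Suc k)
  show ?case
    by (rule C_k_SucI[OF DERIV_add[OF C_k_SucE(1)[OF Suc.prems(1)] C_k_SucE(1)[OF Suc.prems(2)]]
          Suc.IH[OF C_k_SucE(2)[OF Suc.prems(1)] C_k_SucE(2)[OF Suc.prems(2)]]])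
qed

lemma C_k_mult:
  "C_k k f \<Longrightarrow> C_k k g \<Longrightarrow> C_k k (\<lambda>x. f x * g x)" for f g :: "real \<Rightarrow> real"
proof (induction k arbitrary: f g)
  case 0
  then show ?case by (auto intro: continuous_on_mult)
next
  case (Suc k)
  note f = C_k_SucE[OF Suc.prems(1)] and g = C_k_SucE[OF Suc.prems(2)]
  show ?case
    by (rule C_k_SucI[OF DERIV_mult[OF f(1) g(1)]])
      (intro C_k_add Suc.IH f(2) g(2) C_k_Suc_imp[OF Suc.prems(1)] C_k_Suc_imp[OF Suc.prems(2)])
qed

lemma C_k_const: "C_k k (\<lambda>x :: real. c :: real)"
proof (induction k arbitrary: c)
  case (Suc k)
  show ?case by (rule C_k_SucI[where f'="\<lambda>x. 0"]) (simp_all add: Suc.IH)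
qed simp

lemma C_k_affine:
  "C_k k f \<Longrightarrow> C_k k (\<lambda>x. f (c * x + d))" for f :: "real \<Rightarrow> real"
proof (induction k arbitrary: f)
  case 0
  then show ?case
    by (auto intro!: continuous_on_compose2[where f="\<lambda>x. c * x + d" and g=f] continuous_intros)
next
  case (Suc k)
  have "((\<lambda>x. f (c * x + d)) has_real_derivative deriv f (c * x + d) * c) (at x)" for x
    by (rule DERIV_chain2[OF C_k_SucE(1)[OF Suc.prems]]) (auto intro!: derivative_eq_intros)
  then show ?case
    by (rule C_k_SucI) (intro C_k_mult C_k_const Suc.IH C_k_SucE(2)[OF Suc.prems])
qed

text \<open>
  The factor \<open>x\<^sup>-\<^sup>m\<close> makes the family closed under differentiation up to linear combinations, so
  that all the derivatives of \<open>exp (- 1 / x)\<close> at once are seen to extend smoothly by \<open>0\<close>.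
\<close>

definition flat :: "nat \<Rightarrow> real \<Rightarrow> real"
  where "flat m x = (if 0 < x then exp (- inverse x) * inverse x ^ m else 0)"

lemma flat_nonneg: "0 \<le> flat m x"
  by (simp add: flat_def)

lemma tendsto_flat_0: "(flat m \<longlongrightarrow> 0) (at 0)"
proof -
  have "((\<lambda>x::real. x ^ m / exp x) \<longlongrightarrow> 0) at_top"
    by (rule tendsto_power_div_exp_0)
  then have "((\<lambda>x::real. inverse x ^ m / exp (inverse x)) \<longlongrightarrow> 0) (at_right 0)"
    by (rule filterlim_compose[OF _ filterlim_inverse_at_top_right])
  then have r: "(flat m \<longlongrightarrow> 0) (at_right 0)"
    by (rule Lim_transform_eventually)
      (auto simp: flat_def exp_minus divide_inverse mult.commute eventually_at_filter)
  have "(flat m \<longlongrightarrow> 0) (at_left 0)"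
    by (rule tendsto_eventually) (auto simp: flat_def eventually_at_filter)
  with r show ?thesis by (simp add: filterlim_split_at)
qed

lemma has_real_derivative_flat:
  "(flat m has_real_derivative flat (m + 2) x + - real m * flat (m + 1) x) (at x)"
proof -
  consider "x < 0" | "x = 0" | "x > 0" by linarith
  then show ?thesis
  proof cases
    case 1
    have "((\<lambda>x. 0) has_real_derivative 0) (at x)" by simp
    then have "(flat m has_real_derivative 0) (at x)"
      by (rule has_field_derivative_transform_within_open[of _ _ _ "{..<0}"])
        (use 1 in \<open>auto simp: flat_def\<close>)
    with 1 show ?thesis by (simp add: flat_def)
  next
    case 2
    \<comment> \<open>The difference quotient at \<open>0\<close> is again a member of the family, and it tends to \<open>0\<close>.\<close>
    have "flat m h / h = flat (m + 1) h" for h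
      by (auto simp: flat_def divide_inverse)
    then have "(flat m has_real_derivative 0) (at 0)"
      using tendsto_flat_0[of "m + 1"] by (simp add: DERIV_def flat_def[of _ 0])
    with 2 show ?thesis by (simp add: flat_def)
  next
    case 3
    have "((\<lambda>x. inverse x ^ m) has_real_derivative
        real m * (- (inverse x ^ Suc (Suc 0)) * inverse x ^ (m - Suc 0))) (at x)"
      by (rule DERIV_power[OF DERIV_inverse]) (use 3 in simp)
    moreover have "real m * (- (inverse x ^ Suc (Suc 0)) * inverse x ^ (m - Suc 0)) =
        - real m * inverse x ^ (m + 1)"
      by (cases m) (simp_all add: algebra_simps)
    ultimately have 1: "((\<lambda>x. inverse x ^ m) has_real_derivative - real m * inverse x ^ (m + 1)) (at x)"
      by (rule DERIV_cong)
    have 2: "((\<lambda>x. exp (- inverse x)) has_real_derivative exp (- inverse x) * (inverse x)\<^sup>2) (at x)"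
      using 3 by (auto intro!: derivative_eq_intros simp: power2_eq_square)
    have "((\<lambda>x. exp (- inverse x) * inverse x ^ m) has_real_derivative
        exp (- inverse x) * inverse x ^ (m + 2) + - real m * (exp (- inverse x) * inverse x ^ (m + 1))) (at x)"
      by (rule DERIV_cong[OF DERIV_mult[OF 2 1]]) (simp add: power_add algebra_simps power2_eq_square)
    then have "(flat m has_real_derivative
        exp (- inverse x) * inverse x ^ (m + 2) + - real m * (exp (- inverse x) * inverse x ^ (m + 1))) (at x)"
      by (rule has_field_derivative_transform_within_open[of _ _ _ "{0<..}"])
        (use 3 in \<open>auto simp: flat_def\<close>)
    with 3 show ?thesis by (simp add: flat_def)
  qed
qed

lemma C_k_flat: "C_k k (flat m)"
proof (induction k arbitrary: m)
  case 0
  show ?case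
    using has_real_derivative_flat
    by (auto intro!: continuous_at_imp_continuous_on DERIV_isCont)
next
  case (Suc k)
  show ?case
    by (rule C_k_SucI[OF has_real_derivative_flat]) (intro C_k_add C_k_mult C_k_const Suc.IH)
qed

text \<open>
  A smooth transition from \<open>0\<close> to \<open>1\<close>: the normalised primitive of the smooth bump
  \<open>exp (- 1 / x) * exp (- 1 / (1 - x))\<close>, which lives on \<open>[0, 1]\<close>. Its derivative \<open>s\<close> is a
  nonnegative kernel of mass one, and differences of rescaled copies of \<open>S\<close> are test functions that
  approximate the indicator function of an interval.
\<close>

lemma smooth_step_exists:
  obtains S s :: "real \<Rightarrow> real"
  where "smooth S" and "\<And>x. (S has_real_derivative s x) (at x)" and "continuous_on UNIV s"
    and "\<And>x. 0 \<le> s x" and "\<And>x. x \<le> 0 \<Longrightarrow> S x = 0" and "\<And>x. 1 \<le> x \<Longrightarrow> S x = 1"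
    and "\<And>x. 0 \<le> S x" and "\<And>x. S x \<le> 1" and "\<And>x. x \<notin> {0..1} \<Longrightarrow> s x = 0"
proof -
  \<comment> \<open>The argument of the second factor is in the form of \<open>C_k_affine\<close>.\<close>
  define b where "b x = flat 0 x * flat 0 (- 1 * x + 1)" for x
  have smooth_b: "C_k k b" for k
    unfolding b_def by (intro C_k_mult C_k_flat C_k_affine)
  have cont_b: "continuous_on UNIV b" using smooth_b[of 0] by simp
  have b_pos: "0 < b x" if "0 < x" "x < 1" for x
    using that by (simp add: b_def flat_def)
  have b_nonneg: "0 \<le> b x" for x by (simp add: b_def flat_nonneg)
  have b_zero: "b x = 0" if "x \<le> 0 \<or> 1 \<le> x" for x
    using that by (auto simp: b_def flat_def)
  obtain G where G': "\<And>x. (G has_vector_derivative b x) (at x)"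
    using einterval_antiderivative[of "-\<infinity>" \<infinity> b] cont_b
    by (auto simp: continuous_on_eq_continuous_at)
  then have G: "(G has_real_derivative b x) (at x)" for x
    by (simp add: has_real_derivative_iff_has_vector_derivative)
  have cont_G: "continuous_on A G" for A
    by (intro continuous_at_imp_continuous_on ballI DERIV_isCont[OF G])
  have G0: "(G has_real_derivative 0) (at x)" if "x \<le> 0 \<or> 1 \<le> x" for x
    using G[of x] b_zero[OF that] by simp
  have mono: "G x \<le> G y" if "x \<le> y" for x y
    by (rule DERIV_nonneg_imp_nondecreasing[OF that]) (rule exI, rule conjI, rule G, rule b_nonneg)
  have left: "G x = G 0" if "x \<le> 0" for x
  proof (cases "x = 0")
    case False
    with that have "x < 0" by simp
    then show ?thesis
      by (rule DERIV_isconst_end[OF _ cont_G, symmetric]) (simp add: G0)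
  qed simp
  have right: "G x = G 1" if "1 \<le> x" for x
  proof (cases "x = 1")
    case False
    with that have "1 < x" by simp
    then show ?thesis
      by (rule DERIV_isconst_end[OF _ cont_G]) (simp add: G0)
  qed simp
  have "G 0 < G 1"
    by (rule DERIV_pos_imp_increasing_open[OF _ _ cont_G]) (simp, rule exI, rule conjI, rule G, rule b_pos)
  define Z where "Z = G 1 - G 0"
  have Z: "0 < Z" using \<open>G 0 < G 1\<close> by (simp add: Z_def)
  define S where "S x = (G x - G 0) / Z" for x
  define s where "s x = b x * inverse Z" for x
  have S': "(S has_real_derivative s x) (at x)" for x
    unfolding S_def s_def using Z by (auto intro!: derivative_eq_intros G simp: divide_inverse)
  have "C_k k s" for k unfolding s_def by (intro C_k_mult smooth_b C_k_const)
  then have S_Suc: "C_k (Suc k) S" for k by (rule C_k_SucI[OF S'])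
  have "smooth S" unfolding smooth_def using C_k_Suc_imp[OF S_Suc] by blast
  have "continuous_on UNIV s" using \<open>C_k 0 s\<close> by simp
  have "G x \<le> G 1" for x using mono[of x 1] right[of x] by linarith
  then have S1: "S x \<le> 1" for x using Z by (simp add: S_def Z_def)
  have "G 0 \<le> G x" for x using mono[of 0 x] left[of x] by linarith
  then have S0: "0 \<le> S x" for x using Z by (simp add: S_def)
  show ?thesis
  proof (rule that[of S s])
    show "S x = 0" if "x \<le> 0" for x using left[OF that] by (simp add: S_def)
    show "S x = 1" if "1 \<le> x" for x using right[OF that] Z by (simp add: S_def Z_def)
    show "0 \<le> s x" for x using b_nonneg[of x] Z by (simp add: s_def)
    show "s x = 0" if "x \<notin> {0..1}" for x using that b_zero[of x] by (auto simp: s_def)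
  qed fact+
qed

section \<open>Weak derivatives in time\<close>

lemma measurable_lebesgue_continuous:
  "continuous_on UNIV f \<Longrightarrow> f \<in> borel_measurable lebesgue"
  for f :: "real \<Rightarrow> 'h::{banach,second_countable_topology}"
  using borel_measurable_continuous_onI[of f] by (auto intro: measurable_completion)

lemma set_integrable_bounded:
  fixes f :: "real \<Rightarrow> 'h::{banach,second_countable_topology}"
  assumes "f \<in> borel_measurable lebesgue" and "\<And>t. norm (f t) \<le> C"
  shows "set_integrable lebesgue {a..b} f"
  unfolding set_integrable_def
proof (rule Bochner_Integration.integrable_bound)
  show "integrable lebesgue (\<lambda>t. C * indicator {a..b} t)"
    by (intro integrable_mult_right) (auto simp: integrable_indicator_iff emeasure_lborel_Icc_eq)
  show "AE t in lebesgue. norm (indicator {a..b} t *\<^sub>R f t) \<le> norm (C * indicator {a..b} t)"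
    using assms(2) by (intro AE_I2) (auto simp: indicator_def intro: order_trans[OF _ abs_ge_self])
  show "(\<lambda>t. indicator {a..b} t *\<^sub>R f t) \<in> borel_measurable lebesgue"
    by (intro borel_measurable_scaleR borel_measurable_indicator assms) simp
qed

lemma set_integrable_continuous:
  fixes f :: "real \<Rightarrow> 'h::{banach,second_countable_topology}"
  assumes "continuous_on {a..b} f"
  shows "set_integrable lebesgue {a..b} f"
  using borel_integrable_atLeastAtMost'[OF assms] borel_measurable_continuous_on_indicator[OF _ assms]
  by (simp add: set_integrable_def integrable_completion)

lemma LINT_Icc_FTC:
  fixes F f :: "real \<Rightarrow> real"
  assumes "a \<le> b" and "\<And>x. a \<le> x \<Longrightarrow> x \<le> b \<Longrightarrow> (F has_real_derivative f x) (at x)"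
    and "continuous_on {a..b} f"
  shows "(LINT x:{a..b}|lebesgue. f x) = F b - F a"
proof -
  have "(LINT x|lborel. indicator {a..b} x *\<^sub>R f x) = F b - F a"
    using assms
    by (intro integral_FTC_Icc)
      (auto simp: has_real_derivative_iff_has_vector_derivative intro: has_vector_derivative_at_within)
  then show ?thesis
    using borel_measurable_continuous_on_indicator[OF _ assms(3)]
    by (simp add: set_lebesgue_integral_def integral_completion)
qed

lemma norm_LINT_Icc_le:
  fixes f :: "real \<Rightarrow> 'h::{banach,second_countable_topology}"
  assumes "a \<le> b" "set_integrable lebesgue {a..b} f" "\<And>t. a \<le> t \<Longrightarrow> t \<le> b \<Longrightarrow> norm (f t) \<le> C"
  shows "norm (LINT t:{a..b}|lebesgue. f t) \<le> C * (b - a)"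
proof -
  have "norm (LINT t:{a..b}|lebesgue. f t) \<le> (LINT t:{a..b}|lebesgue. norm (f t))"
    using assms(2) by (rule set_integral_norm_bound)
  also have "\<dots> \<le> (LINT t:{a..b}|lebesgue. C)"
    using assms by (intro set_integral_mono set_integrable_norm set_integrable_continuous[OF continuous_on_const]) auto
  also have "\<dots> = C * (b - a)"
  proof -
    have "((\<lambda>t. C * t) has_real_derivative C) (at t)" for t
      by (auto intro!: derivative_eq_intros)
    from LINT_Icc_FTC[OF assms(1) this] show ?thesis by (simp add: algebra_simps)
  qed
  finally show ?thesis .
qed

text \<open>
  A weighted average is as close to \<open>x\<close> as the values that are averaged. The kernel enters through
  its primitive \<open>P\<close>, whose increment is its mass.
\<close>

lemma approximate_identity:
  fixes f :: "real \<Rightarrow> 'h::{banach,second_countable_topology}" and P k :: "real \<Rightarrow> real"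
  assumes ab: "a \<le> b" "{a..b} \<subseteq> A"
    and P: "\<And>t. (P has_real_derivative k t) (at t)" "P b - P a = 1"
    and k: "continuous_on {a..b} k" "\<And>t. 0 \<le> k t" "\<And>t. t \<notin> {a..b} \<Longrightarrow> k t = 0"
    and f: "continuous_on {a..b} f" "\<And>t. a \<le> t \<Longrightarrow> t \<le> b \<Longrightarrow> norm (f t - x) \<le> e"
  shows "set_integrable lebesgue A (\<lambda>t. k t *\<^sub>R f t)"
    and "norm ((LINT t:A|lebesgue. k t *\<^sub>R f t) - x) \<le> e"
proof -
  have kf: "set_integrable lebesgue {a..b} (\<lambda>t. k t *\<^sub>R f t)"
    and kx: "set_integrable lebesgue {a..b} (\<lambda>t. k t *\<^sub>R x)"
    and kn: "set_integrable lebesgue {a..b} (\<lambda>t. k t * norm (f t - x))"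
    and ke: "set_integrable lebesgue {a..b} (\<lambda>t. k t * e)"
    and kd: "set_integrable lebesgue {a..b} (\<lambda>t. k t *\<^sub>R (f t - x))"
    and ki: "set_integrable lebesgue {a..b} k"
    by (intro set_integrable_continuous continuous_intros k f)+
  have eq: "indicator A t *\<^sub>R (k t *\<^sub>R f t) = indicator {a..b} t *\<^sub>R (k t *\<^sub>R f t)" for t
    using ab(2) k(3)[of t] by (auto simp: indicator_def)
  show "set_integrable lebesgue A (\<lambda>t. k t *\<^sub>R f t)"
    using kf unfolding set_integrable_def eq .
  have one: "(LINT t:{a..b}|lebesgue. k t) = 1"
    using LINT_Icc_FTC[OF ab(1) P(1) k(1)] P(2) by simp
  have "(LINT t|lebesgue. (indicator {a..b} t *\<^sub>R k t) *\<^sub>R x) = (LINT t:{a..b}|lebesgue. k t) *\<^sub>R x"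
    unfolding set_lebesgue_integral_def
    by (rule integral_scaleR_left) (use ki in \<open>simp add: set_integrable_def\<close>)
  then have "(LINT t:{a..b}|lebesgue. k t *\<^sub>R x) = x"
    unfolding one by (simp add: set_lebesgue_integral_def)
  then have "(LINT t:A|lebesgue. k t *\<^sub>R f t) - x = (LINT t:{a..b}|lebesgue. k t *\<^sub>R f t) - (LINT t:{a..b}|lebesgue. k t *\<^sub>R x)"
    unfolding set_lebesgue_integral_def eq by simp
  also have "\<dots> = (LINT t:{a..b}|lebesgue. k t *\<^sub>R (f t - x))"
    by (simp add: set_integral_diff(2)[OF kf kx, symmetric] scaleR_diff_right)
  finally have "norm ((LINT t:A|lebesgue. k t *\<^sub>R f t) - x) \<le> (LINT t:{a..b}|lebesgue. k t * norm (f t - x))"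
    using set_integral_norm_bound[OF kd] k(2) by simp
  also have "\<dots> \<le> (LINT t:{a..b}|lebesgue. k t * e)"
    using k(2) f(2) by (intro set_integral_mono kn ke mult_left_mono) auto
  also have "\<dots> = e" using one by (simp add: set_integral_mult_left)
  finally show "norm ((LINT t:A|lebesgue. k t *\<^sub>R f t) - x) \<le> e" .
qed

text \<open>
  A continuous function with a bounded weak derivative is the primitive of that derivative. Test
  the weak formula with smooth approximations of the indicator function of \<open>[a, b]\<close> that rise on
  \<open>[a, a + 1 / c]\<close> and fall on \<open>[b, b + 1 / c]\<close>. As \<open>c\<close> tends to infinity, the side with the
  derivative of the test function concentrates at the two end points, where \<open>f\<close> is continuous, and
  the other side tends to the integral of \<open>g\<close> by dominated convergence.
\<close>

lemma weak_time_derivative_imp_integral: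
  fixes f g :: "real \<Rightarrow> 'h::{banach,second_countable_topology}"
  assumes weak: "weak_time_derivative f g" and f: "continuous_on {0..} f"
    and g: "g \<in> borel_measurable lebesgue" and gC: "\<And>t. norm (g t) \<le> C"
    and ab: "0 < a" "a \<le> b"
  shows "f b - f a = (LINT t:{a..b}|lebesgue. g t)"
proof -
  obtain S s :: "real \<Rightarrow> real" where smooth: "smooth S"
    and S': "\<And>x. (S has_real_derivative s x) (at x)" and s: "continuous_on UNIV s" "\<And>x. 0 \<le> s x"
    and S0: "\<And>x. x \<le> 0 \<Longrightarrow> S x = 0" and S1: "\<And>x. 1 \<le> x \<Longrightarrow> S x = 1"
    and S_ge: "\<And>x. 0 \<le> S x" and S_le: "\<And>x. S x \<le> 1" and s0: "\<And>x. x \<notin> {0..1} \<Longrightarrow> s x = 0"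
    by (rule smooth_step_exists) blast
  define c where "c n = real (Suc n)" for n
  have c: "1 \<le> c n" for n by (simp add: c_def)
  \<comment> \<open>\<open>P p n\<close> rises from \<open>0\<close> to \<open>1\<close> on \<open>[p, p + 1 / c n]\<close>, and \<open>k p n\<close> is its derivative.\<close>
  define P where "P p n t = S (c n * t + - c n * p)" for p n t
  define k where "k p n t = s (c n * t + - c n * p) * c n" for p n t
  have P': "(P p n has_real_derivative k p n t) (at t)" for p n t
    unfolding P_def k_def by (rule DERIV_chain2[OF S']) (auto intro!: derivative_eq_intros)
  have k_cont: "continuous_on B (k p n)" for p n B
    unfolding k_def by (intro continuous_intros continuous_on_compose2[OF s(1)]) auto
  have k_nonneg: "0 \<le> k p n t" for p n t using s(2) c[of n] by (simp add: k_def)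
  have k_zero: "k p n t = 0" if "t \<notin> {p..p + 1 / c n}" for p n t
  proof -
    have "c n * t + - c n * p \<notin> {0..1}"
      using that c[of n] mult_less_cancel_left_pos[of "c n" t p] by (auto simp: field_simps)
    then show ?thesis by (simp add: k_def s0)
  qed
  have P0: "P p n t = 0" if "t \<le> p" for p n t
    using that c[of n] by (auto simp: P_def intro!: S0)
  have P1: "P p n t = 1" if "p + 1 / c n \<le> t" for p n t
    using that c[of n] by (auto simp: P_def field_simps intro!: S1)
  have delta: "set_integrable lebesgue {0<..} (\<lambda>t. k p n t *\<^sub>R f t)" if "0 < p" for p n
  proof -
    have fc: "continuous_on {p..p + 1 / c n} f"
      using that by (intro continuous_on_subset[OF f]) auto
    have "bounded (f ` {p..p + 1 / c n})"
      by (intro compact_imp_bounded compact_continuous_image fc) simp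
    then obtain M where M: "\<forall>x\<in>f ` {p..p + 1 / c n}. norm x \<le> M"
      unfolding bounded_iff ..
    show "set_integrable lebesgue {0<..} (\<lambda>t. k p n t *\<^sub>R f t)"
      by (rule approximate_identity(1)[where P="P p n" and a=p and b="p + 1 / c n" and x=0 and e=M])
        (use that c[of n] M in \<open>auto intro!: P' k_cont k_nonneg k_zero fc simp: P0 P1\<close>)
  qed
  have lim: "(\<lambda>n. LINT t:{0<..}|lebesgue. k p n t *\<^sub>R f t) \<longlonglongrightarrow> f p" if "0 < p" for p
  proof (rule tendstoI)
    fix e :: real assume "0 < e"
    obtain d where d: "0 < d" "\<And>t. 0 \<le> t \<Longrightarrow> dist t p < d \<Longrightarrow> dist (f t) (f p) < e / 2"
      using f[unfolded continuous_on_iff, rule_format, of p "e / 2"] \<open>0 < p\<close> \<open>0 < e\<close>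
      by (metis atLeast_iff half_gt_zero less_imp_le)
    have "(\<lambda>n. 1 / c n) \<longlonglongrightarrow> 0" unfolding c_def by (rule LIMSEQ_Suc[OF lim_1_over_n])
    then have "\<forall>\<^sub>F n in sequentially. 1 / c n < d" using d(1) by (rule order_tendstoD)
    then show "\<forall>\<^sub>F n in sequentially. dist (LINT t:{0<..}|lebesgue. k p n t *\<^sub>R f t) (f p) < e"
    proof eventually_elim
      case (elim n)
      have "norm ((LINT t:{0<..}|lebesgue. k p n t *\<^sub>R f t) - f p) \<le> e / 2"
      proof (rule approximate_identity(2)[where P="P p n" and a=p and b="p + 1 / c n"])
        show "norm (f t - f p) \<le> e / 2" if "p \<le> t" "t \<le> p + 1 / c n" for t
          using d(2)[of t] that \<open>0 < p\<close> elim by (auto simp: dist_norm)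
        show "continuous_on {p..p + 1 / c n} f"
          using that by (intro continuous_on_subset[OF f]) auto
      qed (use that c[of n] in \<open>auto intro!: P' k_cont k_nonneg k_zero simp: P0 P1\<close>)
      with \<open>0 < e\<close> show ?case by (simp add: dist_norm)
    qed
  qed
  define \<phi> where "\<phi> n t = P a n t - P b n t" for n t
  have \<phi>': "(\<phi> n has_real_derivative k a n t - k b n t) (at t)" for n t
    unfolding \<phi>_def by (intro DERIV_diff P')
  have test: "\<phi> n \<in> test_functions {0<..}" for n
    unfolding test_functions_def mem_Collect_eq
  proof (intro conjI exI allI impI)
    have "C_k j (\<lambda>t. P a n t + - 1 * P b n t)" for j
      unfolding P_def using smooth by (intro C_k_add C_k_mult C_k_const C_k_affine) (auto simp: smooth_def)
    then show "smooth (\<phi> n)" by (simp add: smooth_def \<phi>_def[abs_def])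
    show "compact {a..b + 1 / c n}" by simp
    show "{a..b + 1 / c n} \<subseteq> {0<..}" using ab by auto
    fix t assume t: "t \<notin> {a..b + 1 / c n}"
    show "\<phi> n t = 0"
    proof (cases "t < a")
      case True
      then show ?thesis using ab by (simp add: \<phi>_def P0)
    next
      case False
      with t have "b + 1 / c n \<le> t" by auto
      then show ?thesis using ab by (simp add: \<phi>_def P1)
    qed
  qed
  have deriv\<phi>: "deriv (\<phi> n) t *\<^sub>R f t = k a n t *\<^sub>R f t - k b n t *\<^sub>R f t" for n t
    using DERIV_imp_deriv[OF \<phi>'[of n t]] by (simp add: scaleR_diff_left)
  have "(LINT t:{0<..}|lebesgue. deriv (\<phi> n) t *\<^sub>R f t) =
      (LINT t:{0<..}|lebesgue. k a n t *\<^sub>R f t) - (LINT t:{0<..}|lebesgue. k b n t *\<^sub>R f t)" for n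
    unfolding deriv\<phi> using ab by (intro set_integral_diff(2) delta) auto
  then have "(\<lambda>n. LINT t:{0<..}|lebesgue. deriv (\<phi> n) t *\<^sub>R f t) \<longlonglongrightarrow> f a - f b"
    using tendsto_diff[OF lim[of a] lim[of b]] ab by simp
  then have L1: "(\<lambda>n. - (LINT t:{0<..}|lebesgue. \<phi> n t *\<^sub>R g t)) \<longlonglongrightarrow> f a - f b"
    using weak test unfolding weak_time_derivative_def by simp
  have \<phi>_cont: "continuous_on UNIV (\<phi> n)" for n
    by (intro continuous_at_imp_continuous_on ballI DERIV_isCont[OF \<phi>'])
  have C0: "0 \<le> C" using norm_ge_zero gC order_trans by blast
  have L2: "(\<lambda>n. LINT t:{0<..}|lebesgue. \<phi> n t *\<^sub>R g t) \<longlonglongrightarrow> (LINT t:{a..b}|lebesgue. g t)"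
    unfolding set_lebesgue_integral_def
  proof (rule integral_dominated_convergence[where w="\<lambda>t. C * indicator {a..b + 1} t"])
    show "(\<lambda>t. indicator {a..b} t *\<^sub>R g t) \<in> borel_measurable lebesgue"
      by (intro borel_measurable_scaleR borel_measurable_indicator g) simp
    show "(\<lambda>t. indicator {0<..} t *\<^sub>R \<phi> n t *\<^sub>R g t) \<in> borel_measurable lebesgue" for n
    proof -
      have "\<phi> n \<in> borel_measurable lebesgue"
        by (rule measurable_lebesgue_continuous[OF \<phi>_cont])
      then show ?thesis by (intro borel_measurable_scaleR borel_measurable_indicator g) simp
    qed
    show "integrable lebesgue (\<lambda>t. C * indicator {a..b + 1} t)"
      by (intro integrable_mult_right) (auto simp: integrable_indicator_iff emeasure_lborel_Icc_eq)
    show "AE t in lebesgue. (\<lambda>n. indicator {0<..} t *\<^sub>R \<phi> n t *\<^sub>R g t) \<longlonglongrightarrow> indicator {a..b} t *\<^sub>R g t"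
    proof -
      \<comment> \<open>At \<open>t = a\<close> the test functions vanish, whereas the indicator function of \<open>[a, b]\<close> is \<open>1\<close>.\<close>
      have "AE t in lebesgue. t \<noteq> a" by (rule AE_completion[OF AE_lborel_singleton])
      then show ?thesis
      proof eventually_elim
        case (elim t)
        have "(\<lambda>n. P p n t) \<longlonglongrightarrow> (if t \<le> p then 0 else 1)" for p
        proof (cases "t \<le> p")
          case False
          have "(\<lambda>n. 1 / c n) \<longlonglongrightarrow> 0" unfolding c_def by (rule LIMSEQ_Suc[OF lim_1_over_n])
          then have "\<forall>\<^sub>F n in sequentially. 1 / c n < t - p" by (rule order_tendstoD) (use False in simp)
          then have "\<forall>\<^sub>F n in sequentially. P p n t = 1" by eventually_elim (auto intro!: P1)
          then show ?thesis using False by (simp add: tendsto_eventually)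
        qed (simp add: P0)
        from tendsto_diff[OF this[of a] this[of b]]
        have "(\<lambda>n. \<phi> n t) \<longlonglongrightarrow> (if t \<le> a then 0 else 1) - (if t \<le> b then 0 else 1)"
          by (simp add: \<phi>_def)
        also have "(if t \<le> a then 0 else 1) - (if t \<le> b then 0 else 1) = (indicator {a..b} t :: real)"
          using elim ab by (auto simp: indicator_def)
        finally have "(\<lambda>n. indicator {0<..} t *\<^sub>R \<phi> n t *\<^sub>R g t) \<longlonglongrightarrow> indicator {0<..} t *\<^sub>R (indicator {a..b} t :: real) *\<^sub>R g t"
          by (intro tendsto_intros)
        then show ?case using ab by (auto simp: indicator_def split: if_splits)
      qed
    qed
    show "AE t in lebesgue. norm (indicator {0<..} t *\<^sub>R \<phi> n t *\<^sub>R g t) \<le> C * indicator {a..b + 1} t" for n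
    proof (rule AE_I2)
      fix t :: real
      have "0 \<le> P p n t" "P p n t \<le> 1" for p
        using S_ge S_le by (simp_all add: P_def)
      from this[of a] this[of b] have "\<bar>\<phi> n t\<bar> \<le> 1"
        by (simp add: \<phi>_def abs_le_iff)
      then have "\<bar>\<phi> n t\<bar> * norm (g t) \<le> 1 * C"
        using gC[of t] by (intro mult_mono) auto
      moreover have "\<phi> n t = 0" if "t \<notin> {a..b + 1}"
      proof (cases "t < a")
        case False
        with that have "b + 1 \<le> t" by auto
        moreover have "1 / c n \<le> 1" using c[of n] by simp
        ultimately show ?thesis using ab by (simp add: \<phi>_def P1)
      qed (use ab in \<open>simp add: \<phi>_def P0\<close>)
      ultimately show "norm (indicator {0<..} t *\<^sub>R \<phi> n t *\<^sub>R g t) \<le> C * indicator {a..b + 1} t"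
        using C0 by (auto simp: indicator_def)
    qed
  qed
  have "f a - f b = - (LINT t:{a..b}|lebesgue. g t)"
    by (rule LIMSEQ_unique[OF L1 tendsto_minus[OF L2]])
  then show ?thesis by (metis minus_diff_eq minus_minus)
qed

section \<open>Calculus along bounded primitives\<close>

text \<open>
  The derivative of such a function vanishes. This is how product rules are proved below for
  functions that are differentiable only almost everywhere.
\<close>

lemma quadratic_increments_imp_eq:
  fixes Q :: "real \<Rightarrow> real"
  assumes "s \<le> t" and Q: "\<And>a b. s \<le> a \<Longrightarrow> a \<le> b \<Longrightarrow> b \<le> t \<Longrightarrow> \<bar>Q b - Q a\<bar> \<le> K * (b - a)\<^sup>2"
  shows "Q t = Q s"
proof -
  have "\<exists>c. \<forall>x\<in>{s..t}. Q x = c"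
  proof (rule has_field_derivative_zero_constant)
    fix x assume x: "x \<in> {s..t}"
    have "((\<lambda>y. (Q y - Q x) / (y - x)) \<longlongrightarrow> 0) (at x within {s..t})"
    proof (rule Lim_null_comparison)
      show "((\<lambda>y. K * \<bar>y - x\<bar>) \<longlongrightarrow> 0) (at x within {s..t})"
        by (auto intro!: tendsto_eq_intros)
      have "norm ((Q y - Q x) / (y - x)) \<le> K * \<bar>y - x\<bar>" if y: "y \<in> {s..t}" "y \<noteq> x" for y
      proof -
        have "\<bar>Q y - Q x\<bar> \<le> K * \<bar>y - x\<bar> * \<bar>y - x\<bar>"
          using Q[of x y] Q[of y x] x y
          by (cases "x \<le> y") (auto simp: power2_eq_square abs_minus_commute mult.assoc)
        then show ?thesis using y(2) by (simp add: divide_le_eq)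
      qed
      then show "\<forall>\<^sub>F y in at x within {s..t}. norm ((Q y - Q x) / (y - x)) \<le> K * \<bar>y - x\<bar>"
        by (auto simp: eventually_at_filter)
    qed
    then show "(Q has_field_derivative 0) (at x within {s..t})"
      by (simp add: has_field_derivative_iff)
  qed simp
  with \<open>s \<le> t\<close> show ?thesis by auto
qed

lemma LINT_Icc_combine:
  fixes f :: "real \<Rightarrow> 'h::{banach,second_countable_topology}"
  assumes "a \<le> b" "b \<le> c" and f: "set_integrable lebesgue {a..c} f"
  shows "(LINT t:{a..c}|lebesgue. f t) = (LINT t:{a..b}|lebesgue. f t) + (LINT t:{b..c}|lebesgue. f t)"
proof -
  have "AE t in lebesgue. t \<noteq> b" by (rule AE_completion[OF AE_lborel_singleton])
  then have "(LINT t:{a..b} \<union> {b..c}|lebesgue. f t) = (LINT t:{a..b}|lebesgue. f t) + (LINT t:{b..c}|lebesgue. f t)"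
    using assms
    by (intro set_integral_Un_AE) (auto elim: eventually_mono intro: set_integrable_subset[OF f])
  then show ?thesis using assms by (simp add: ivl_disj_un_two_touch)
qed

lemma set_integrable_inner_left:
  fixes f :: "real \<Rightarrow> 'h::{banach,second_countable_topology,real_inner}"
  assumes "set_integrable lebesgue A f"
  shows "set_integrable lebesgue A (\<lambda>t. f t \<bullet> x)"
  using integrable_inner_left[of x lebesgue "\<lambda>t. indicator A t *\<^sub>R f t"] assms
  by (simp add: set_integrable_def)

lemma LINT_Icc_inner_left:
  fixes f :: "real \<Rightarrow> 'h::{banach,second_countable_topology,real_inner}"
  assumes "set_integrable lebesgue {a..b} f"
  shows "(LINT t:{a..b}|lebesgue. f t \<bullet> x) = (LINT t:{a..b}|lebesgue. f t) \<bullet> x"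
  unfolding set_lebesgue_integral_def using assms
  by (subst integral_inner_left[symmetric]) (auto simp: set_integrable_def)

lemma AE_lebesgue_ex_between:
  assumes "AE t in lebesgue. P t" and "a < (b :: real)"
  obtains t where "a < t" "t < b" "P t"
proof -
  have "\<exists>t\<in>{a<..<b}. P t"
  proof (rule ccontr)
    assume "\<not> ?thesis"
    then have "AE t in lebesgue. t \<notin> {a<..<b}" using assms(1) by (auto elim: eventually_mono)
    then have "{a<..<b} \<in> null_sets lebesgue" by (subst AE_iff_null_sets) auto
    then show False using \<open>a < b\<close> by (simp add: null_sets_def)
  qed
  then show ?thesis using that by auto
qed

text \<open>
  A closed condition that holds at almost every time just after \<open>t\<close> passes to the limit.
\<close>

lemma continuous_AE_in_closed:
  fixes f :: "real \<Rightarrow> 'h::topological_space"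
  assumes f: "continuous_on {0..} f" and A: "closed A" and P: "AE r in lebesgue. 0 < r \<longrightarrow> P r"
    and t: "0 \<le> t" "0 < e" and PA: "\<And>r. P r \<Longrightarrow> t < r \<Longrightarrow> r < t + e \<Longrightarrow> f r \<in> A"
  shows "f t \<in> A"
proof (rule ccontr)
  assume "f t \<notin> A"
  then have "\<forall>\<^sub>F r in at t within {0..}. f r \<in> - A"
    using f A t by (intro topological_tendstoD[of f "f t"]) (auto simp: continuous_on_def)
  then obtain d where d: "0 < d" "\<And>r. 0 \<le> r \<Longrightarrow> r \<noteq> t \<Longrightarrow> dist r t < d \<Longrightarrow> f r \<notin> A"
    unfolding eventually_at by auto
  obtain r where r: "t < r" "r < t + min d e" "0 < r \<longrightarrow> P r"
    by (rule AE_lebesgue_ex_between[OF P, of t "t + min d e"]) (use t d in auto)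
  have "f r \<notin> A" using r t by (intro d) (auto simp: dist_real_def)
  then show False using PA[of r] r t by auto
qed

text \<open>
  The product rule for primitives of bounded functions, in integrated form. On a short interval
  \<open>[a, b]\<close> the increment of \<open>f \<bullet> g\<close> is the integral of \<open>f' \<bullet> g b + f a \<bullet> g'\<close> exactly. Since \<open>f\<close>
  and \<open>g\<close> are Lipschitz continuous, freezing them at the end points costs only
  \<open>O((b - a)\<^sup>2)\<close>, and errors of this order add up to nothing.
\<close>

lemma inner_product_rule:
  fixes f g f' g' :: "real \<Rightarrow> 'h::{banach,second_countable_topology,real_inner}"
  assumes f: "continuous_on UNIV f" and g: "continuous_on UNIV g"
    and f': "f' \<in> borel_measurable lebesgue" and g': "g' \<in> borel_measurable lebesgue"
    and bound: "\<And>t. norm (f t) \<le> C" "\<And>t. norm (g t) \<le> C" "\<And>t. norm (f' t) \<le> C" "\<And>t. norm (g' t) \<le> C"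
    and f_int: "\<And>a b. 0 < a \<Longrightarrow> a \<le> b \<Longrightarrow> f b - f a = (LINT t:{a..b}|lebesgue. f' t)"
    and g_int: "\<And>a b. 0 < a \<Longrightarrow> a \<le> b \<Longrightarrow> g b - g a = (LINT t:{a..b}|lebesgue. g' t)"
    and st: "0 < s" "s \<le> t"
  shows "f t \<bullet> g t - f s \<bullet> g s = (LINT r:{s..t}|lebesgue. f' r \<bullet> g r + f r \<bullet> g' r)"
proof -
  have C: "0 \<le> C" using order_trans[OF norm_ge_zero bound(1)] .
  have inner_le: "\<bar>x \<bullet> y\<bar> \<le> A * B" if "norm x \<le> A" "norm y \<le> B" for x y :: 'h and A B
    using Cauchy_Schwarz_ineq2[of x y] mult_mono'[OF that norm_ge_zero norm_ge_zero] by linarith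
  define h where "h r = f' r \<bullet> g r + f r \<bullet> g' r" for r
  have h_int: "set_integrable lebesgue {a..b} h" for a b
  proof (rule set_integrable_bounded)
    show "h \<in> borel_measurable lebesgue"
      unfolding h_def
      by (intro borel_measurable_add borel_measurable_inner f' g' measurable_lebesgue_continuous f g)
    show "norm (h r) \<le> C * C + C * C" for r
      unfolding h_def real_norm_def
      by (intro order_trans[OF abs_triangle_ineq] add_mono inner_le bound)
  qed
  have lip: "norm (p b - p a) \<le> C * (b - a)"
    if "0 < a" "a \<le> b" "p' \<in> borel_measurable lebesgue" "\<And>t. norm (p' t) \<le> C"
      "\<And>a b. 0 < a \<Longrightarrow> a \<le> b \<Longrightarrow> p b - p a = (LINT t:{a..b}|lebesgue. p' t)"
    for p p' :: "real \<Rightarrow> 'h" and a b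
    using norm_LINT_Icc_le[OF that(2) set_integrable_bounded[OF that(3,4)] that(4)] that(1,2,5) by simp
  define Q where "Q x = f x \<bullet> g x - (LINT r:{s..x}|lebesgue. h r)" for x
  have "Q t = Q s"
  proof (rule quadratic_increments_imp_eq[OF st(2)])
    fix a b assume ab: "s \<le> a" "a \<le> b" "b \<le> t"
    with st have a0: "0 < a" by simp
    have i1: "set_integrable lebesgue {a..b} (\<lambda>r. f' r \<bullet> g b)"
      by (rule set_integrable_inner_left[OF set_integrable_bounded[OF f' bound(3)]])
    have i2: "set_integrable lebesgue {a..b} (\<lambda>r. g' r \<bullet> f a)"
      by (rule set_integrable_inner_left[OF set_integrable_bounded[OF g' bound(4)]])
    have "Q b - Q a = f b \<bullet> g b - f a \<bullet> g a - (LINT r:{a..b}|lebesgue. h r)"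
      using LINT_Icc_combine[OF ab(1,2) h_int] by (simp add: Q_def)
    also have "f b \<bullet> g b - f a \<bullet> g a = (f b - f a) \<bullet> g b + (g b - g a) \<bullet> f a"
      by (simp add: inner_diff_left inner_diff_right inner_commute[of "f a"])
    also have "\<dots> = (LINT r:{a..b}|lebesgue. f' r \<bullet> g b + g' r \<bullet> f a)"
      unfolding f_int[OF a0 ab(2)] g_int[OF a0 ab(2)] set_integral_add(2)[OF i1 i2]
      using LINT_Icc_inner_left[OF set_integrable_bounded[OF f' bound(3)], of a b "g b"]
        LINT_Icc_inner_left[OF set_integrable_bounded[OF g' bound(4)], of a b "f a"] by simp
    also have "\<dots> - (LINT r:{a..b}|lebesgue. h r) = (LINT r:{a..b}|lebesgue. f' r \<bullet> g b + g' r \<bullet> f a - h r)"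
      by (rule set_integral_diff(2)[symmetric, OF set_integral_add(1)[OF i1 i2] h_int])
    also have "\<bar>\<dots>\<bar> \<le> (2 * C * C * (b - a)) * (b - a)"
      unfolding real_norm_def[symmetric]
    proof (rule norm_LINT_Icc_le[OF ab(2)])
      show "set_integrable lebesgue {a..b} (\<lambda>r. f' r \<bullet> g b + g' r \<bullet> f a - h r)"
        by (rule set_integral_diff(1)[OF set_integral_add(1)[OF i1 i2] h_int])
      fix r assume r: "a \<le> r" "r \<le> b"
      have "f' r \<bullet> g b + g' r \<bullet> f a - h r = f' r \<bullet> (g b - g r) - (f r - f a) \<bullet> g' r"
        by (simp add: h_def inner_diff_left inner_diff_right inner_commute)
      moreover have "norm (g b - g r) \<le> C * (b - a)"
        using lip[OF _ r(2) g' bound(4) g_int] a0 r C by (smt (verit) mult_left_mono)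
      then have "\<bar>f' r \<bullet> (g b - g r)\<bar> \<le> C * (C * (b - a))" by (intro inner_le bound)
      moreover have "norm (f r - f a) \<le> C * (b - a)"
        using lip[OF a0 r(1) f' bound(3) f_int] r C by (smt (verit) mult_left_mono)
      then have "\<bar>(f r - f a) \<bullet> g' r\<bar> \<le> C * (b - a) * C" by (intro inner_le bound)
      ultimately show "norm (f' r \<bullet> g b + g' r \<bullet> f a - h r) \<le> 2 * C * C * (b - a)"
        by (simp add: algebra_simps)
    qed
    finally show "\<bar>Q b - Q a\<bar> \<le> (2 * C * C) * (b - a)\<^sup>2"
      by (simp add: power2_eq_square mult.assoc)
  qed
  moreover have "(LINT r:{s..s}|lebesgue. h r) = 0"
    using norm_LINT_Icc_le[of s s h "norm (h s)"] h_int[of s s] by auto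
  ultimately show ?thesis by (simp add: Q_def h_def)
qed

text \<open>
  By monotonicity, \<open>E t * t / 2\<close> is at most the integral of \<open>E\<close> over \<open>[t / 2, t]\<close>. This is a
  Cauchy difference of a bounded increasing function, so it tends to \<open>0\<close>.
\<close>

lemma antimono_integral_bounded_smallo:
  fixes E :: "real \<Rightarrow> real"
  assumes anti: "\<And>s t. 1 \<le> s \<Longrightarrow> s \<le> t \<Longrightarrow> E t \<le> E s" and nonneg: "\<And>t. 1 \<le> t \<Longrightarrow> 0 \<le> E t"
    and E_int: "\<And>b. set_integrable lebesgue {1..b} E"
    and bound: "\<And>t. 1 \<le> t \<Longrightarrow> (LINT r:{1..t}|lebesgue. E r) \<le> M"
  shows "E \<in> o[at_top](\<lambda>t. 1 / t)"
proof (rule landau_o.smallI)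
  fix c :: real assume c: "0 < c"
  define I where "I t = (LINT r:{1..t}|lebesgue. E r)" for t
  \<comment> \<open>The limit of \<open>I\<close>; both \<open>I (t / 2)\<close> and \<open>I t\<close> are within \<open>c / 2\<close> of it once \<open>t / 2\<close> exceeds \<open>T\<close>.\<close>
  define L where "L = Sup (I ` {1..})"
  have ne: "I ` {1..} \<noteq> {}" by auto
  have bdd: "bdd_above (I ` {1..})" using bound by (auto simp: I_def intro!: bdd_aboveI[of _ M])
  have "L - c / 2 < L" using c by simp
  then obtain T where T: "1 \<le> T" "L - c / 2 < I T"
    unfolding L_def less_cSup_iff[OF ne bdd] by auto
  have "\<forall>\<^sub>F t in at_top. 2 * T \<le> t" by (rule eventually_ge_at_top)
  then show "\<forall>\<^sub>F t in at_top. norm (E t) \<le> c * norm (1 / t)"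
  proof eventually_elim
    case (elim t)
    have sub: "set_integrable lebesgue {a..b} E" if "1 \<le> a" for a b
      by (rule set_integrable_subset[OF E_int[of b]]) (use that in auto)
    have I_mono: "E b * (b - a) \<le> I b - I a" if "1 \<le> a" "a \<le> b" for a b
    proof -
      have "E b * (b - a) = (LINT r:{a..b}|lebesgue. E b)"
      proof -
        have "((\<lambda>t. E b * t) has_real_derivative E b) (at t)" for t
          by (auto intro!: derivative_eq_intros)
        from LINT_Icc_FTC[OF that(2) this] show ?thesis by (simp add: algebra_simps)
      qed
      also have "\<dots> \<le> (LINT r:{a..b}|lebesgue. E r)"
        using that anti
        by (intro set_integral_mono sub set_integrable_continuous[OF continuous_on_const]) auto
      also have "\<dots> = I b - I a" using LINT_Icc_combine[OF that E_int] by (simp add: I_def)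
      finally show ?thesis .
    qed
    have "0 \<le> E (t / 2) * (t / 2 - T)" using nonneg[of "t / 2"] elim T(1) by simp
    then have "I T \<le> I (t / 2)" using I_mono[of T "t / 2"] elim T(1) by simp
    moreover have "I t \<le> L" unfolding L_def using elim T(1) by (intro cSup_upper bdd) auto
    moreover have "E t * (t - t / 2) \<le> I t - I (t / 2)" using elim T(1) by (intro I_mono) auto
    ultimately have "E t * t \<le> c" using T(2) by (simp add: field_simps)
    moreover have "0 < t" "0 \<le> E t" using elim T(1) nonneg[of t] by auto
    ultimately show ?case by (simp add: field_simps)
  qed
qed

section \<open>Energy decay for damped gradient flows in a Hilbert space\<close>

text \<open>
  The argument lives in a Hilbert space. It uses of the functional \<open>F\<close> only that it is nonnegative
  and lower semicontinuous (the sublevel sets are closed) and that \<open>0\<close> is a minimiser with value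
  \<open>0\<close>; convexity acts through the subgradients. The equation is required at positive times, whereas
  continuity and bounds are stated for all \<open>t\<close>: a solution on \<open>[0, \<infinity>)\<close> is extended to \<open>t < 0\<close> by
  constants.
\<close>

locale damped_gradient_flow =
  fixes H :: "'h::{banach,second_countable_topology,real_inner} set" and F :: "'h \<Rightarrow> ereal"
    and \<eta> C :: real and u u' u'' :: "real \<Rightarrow> 'h"
  assumes damping: "0 < \<eta>"
    and F_nonneg: "\<And>x. 0 \<le> F x" and F_zero: "F 0 = 0"
    and closed_H: "closed H" and zero_in_H: "0 \<in> H"
    and closed_sublevel: "\<And>c :: real. closed {x. F x \<le> ereal c}"
    and u_cont: "continuous_on UNIV u" and u'_cont: "continuous_on UNIV u'"
    and u''_meas: "u'' \<in> borel_measurable lebesgue"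
    and u_bound: "\<And>t. norm (u t) \<le> C" and u'_bound: "\<And>t. norm (u' t) \<le> C"
    and u''_bound: "\<And>t. norm (u'' t) \<le> C"
    and u_int: "\<And>a b. 0 < a \<Longrightarrow> a \<le> b \<Longrightarrow> u b - u a = (LINT t:{a..b}|lebesgue. u' t)"
    and u'_int: "\<And>a b. 0 < a \<Longrightarrow> a \<le> b \<Longrightarrow> u' b - u' a = (LINT t:{a..b}|lebesgue. u'' t)"
    and flow: "AE t in lebesgue. 0 < t \<longrightarrow> - u'' t - \<eta> *\<^sub>R u' t \<in> subdifferential H F (u t)"
begin

definition \<xi> :: "real \<Rightarrow> 'h"
  where "\<xi> t = - u'' t - \<eta> *\<^sub>R u' t"

definition \<phi> :: "real \<Rightarrow> real"
  where "\<phi> t = real_of_ereal (F (u t))"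

text \<open>
  Almost every positive time is regular. Regular times are those at which the equation provides the
  subgradient \<open>\<xi> t\<close>, and everything known about \<open>F\<close> along the curve has to come from them.
\<close>

definition regular :: "real \<Rightarrow> bool"
  where "regular t \<longleftrightarrow> \<xi> t \<in> subdifferential H F (u t)"

lemma AE_regular: "AE t in lebesgue. 0 < t \<longrightarrow> regular t"
  using flow by (simp add: regular_def \<xi>_def)

lemma regular_between:
  assumes "0 \<le> a" "a < b"
  obtains t where "a < t" "t < b" "regular t"
  using AE_lebesgue_ex_between[OF AE_regular assms(2)] assms(1) by (metis le_less_trans)

lemma C_nonneg: "0 \<le> C"
  using order_trans[OF norm_ge_zero u_bound] .

lemma \<xi>_bound: "norm (\<xi> t) \<le> (1 + \<eta>) * C"
proof -
  have "norm (\<xi> t) \<le> norm (u'' t) + \<eta> * norm (u' t)"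
    unfolding \<xi>_def using norm_triangle_ineq4[of "- u'' t" "\<eta> *\<^sub>R u' t"] damping by simp
  also have "\<dots> \<le> C + \<eta> * C"
    using damping u''_bound u'_bound by (intro add_mono mult_left_mono) auto
  finally show ?thesis by (simp add: algebra_simps)
qed

lemma \<xi>_meas: "\<xi> \<in> borel_measurable lebesgue"
  unfolding \<xi>_def[abs_def]
  by (intro borel_measurable_diff borel_measurable_uminus borel_measurable_scaleR
      borel_measurable_const u''_meas measurable_lebesgue_continuous u'_cont)

lemma u'_meas: "u' \<in> borel_measurable lebesgue"
  by (rule measurable_lebesgue_continuous[OF u'_cont])

lemma u_meas: "u \<in> borel_measurable lebesgue"
  by (rule measurable_lebesgue_continuous[OF u_cont])

lemma set_integrable_inner:
  fixes p q :: "real \<Rightarrow> 'h"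
  assumes "p \<in> borel_measurable lebesgue" "q \<in> borel_measurable lebesgue"
    and "\<And>t. norm (p t) \<le> A" "\<And>t. norm (q t) \<le> B"
  shows "set_integrable lebesgue {a..b} (\<lambda>t. p t \<bullet> q t)"
proof (rule set_integrable_bounded)
  show "(\<lambda>t. p t \<bullet> q t) \<in> borel_measurable lebesgue"
    using assms by (intro borel_measurable_inner)
  show "norm (p t \<bullet> q t) \<le> A * B" for t
    unfolding real_norm_def
    using Cauchy_Schwarz_ineq2[of "p t" "q t"] mult_mono'[OF assms(3,4) norm_ge_zero norm_ge_zero]
    by (rule order_trans)
qed

lemma u_lipschitz:
  assumes "0 < s" "0 < t"
  shows "norm (u t - u s) \<le> C * \<bar>t - s\<bar>"
proof -
  have *: "norm (u b - u a) \<le> C * (b - a)" if "0 < a" "a \<le> b" for a b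
    using norm_LINT_Icc_le[OF that(2) set_integrable_bounded[OF u'_meas u'_bound] u'_bound]
      u_int[OF that] by simp
  show ?thesis
    using *[of s t] *[of t s] assms by (cases "s \<le> t") (auto simp: norm_minus_commute)
qed

lemma u'_lipschitz:
  assumes "0 < s" "s \<le> t"
  shows "norm (u' t - u' s) \<le> C * (t - s)"
  using norm_LINT_Icc_le[OF assms(2) set_integrable_bounded[OF u''_meas u''_bound] u''_bound]
    u'_int[OF assms] by simp

lemma u_in_closed:
  assumes "closed A" "0 < t" "0 < e"
    and "\<And>s. regular s \<Longrightarrow> 0 < s \<Longrightarrow> \<bar>s - t\<bar> < e \<Longrightarrow> u s \<in> A"
  shows "u t \<in> A"
  using assms
  by (intro continuous_AE_in_closed[OF continuous_on_subset[OF u_cont] _ AE_regular, of A t e]) auto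

lemma u_in_H: "u t \<in> H" if "0 < t"
  by (rule u_in_closed[OF closed_H that zero_less_one]) (simp add: regular_def subdifferential_def)

lemma F_eq_\<phi>: "F (u t) < \<infinity> \<Longrightarrow> F (u t) = ereal (\<phi> t)"
  using F_nonneg[of "u t"] by (cases "F (u t)") (auto simp: \<phi>_def)

lemma regular_finite: "regular t \<Longrightarrow> F (u t) < \<infinity>"
  by (simp add: regular_def subdifferential_def)

lemma subgradient:
  assumes "regular s" "w \<in> H"
  shows "ereal (\<phi> s + \<xi> s \<bullet> (w - u s)) \<le> F w"
proof -
  have "F (u s) + ereal (\<xi> s \<bullet> (w - u s)) \<le> F w"
    using assms by (simp add: regular_def subdifferential_def)
  then show ?thesis using F_eq_\<phi>[OF regular_finite[OF assms(1)]] by simp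
qed

text \<open>The subgradients have norm at most \<open>(1 + \<eta>) * C\<close> and the curve has speed at most \<open>C\<close>.\<close>

definition L :: real where "L = (1 + \<eta>) * C * C"

lemma L_nonneg: "0 \<le> L"
  using damping C_nonneg by (simp add: L_def)

lemma \<xi>_increment:
  assumes "0 < s" "0 < t"
  shows "\<bar>\<xi> r \<bullet> (u t - u s)\<bar> \<le> L * \<bar>t - s\<bar>"
proof -
  have "\<bar>\<xi> r \<bullet> (u t - u s)\<bar> \<le> norm (\<xi> r) * norm (u t - u s)"
    by (rule Cauchy_Schwarz_ineq2)
  also have "\<dots> \<le> ((1 + \<eta>) * C) * (C * \<bar>t - s\<bar>)"
    using damping C_nonneg by (intro mult_mono \<xi>_bound u_lipschitz assms) auto
  finally show ?thesis by (simp add: L_def mult.assoc)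
qed

text \<open>
  Subgradients bound the values of \<open>F\<close> from below only. An upper bound at an arbitrary time \<open>t\<close>
  comes from regular times \<open>r\<close> close to \<open>t\<close>: the subgradient at \<open>r\<close> bounds \<open>F (u r)\<close> above in terms of
  \<open>F (u s)\<close>, and by lower semicontinuity the bound survives \<open>r \<rightarrow> t\<close>.
\<close>

lemma F_upper:
  assumes "regular s" "0 < s" "0 < t" "0 < e"
  shows "F (u t) \<le> ereal (\<phi> s + L * (\<bar>t - s\<bar> + e))"
proof -
  have "u t \<in> {x. F x \<le> ereal (\<phi> s + L * (\<bar>t - s\<bar> + e))}"
  proof (rule u_in_closed[OF closed_sublevel assms(3,4)])
    fix r assume r: "regular r" "0 < r" "\<bar>r - t\<bar> < e"
    have "ereal (\<phi> r + \<xi> r \<bullet> (u s - u r)) \<le> ereal (\<phi> s)"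
      using subgradient[OF r(1) u_in_H[OF assms(2)]] F_eq_\<phi>[OF regular_finite[OF assms(1)]] by simp
    then have "\<phi> r \<le> \<phi> s + L * \<bar>s - r\<bar>"
      using \<xi>_increment[OF r(2) assms(2), of r] by (simp add: abs_le_iff)
    also have "\<dots> \<le> \<phi> s + L * (\<bar>t - s\<bar> + e)"
      using r(3) L_nonneg by (intro add_left_mono mult_left_mono) auto
    finally show "u r \<in> {x. F x \<le> ereal (\<phi> s + L * (\<bar>t - s\<bar> + e))}"
      using F_eq_\<phi>[OF regular_finite[OF r(1)]] by simp
  qed
  then show ?thesis by simp
qed

lemma F_finite: "F (u t) < \<infinity>" if t: "0 < t"
proof -
  obtain s where "t < s" "s < t + 1" "regular s"
    by (rule regular_between[of t "t + 1"]) (use t in auto)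
  then have "F (u t) \<le> ereal (\<phi> s + L * (\<bar>t - s\<bar> + 1))"
    using t by (intro F_upper) auto
  then show ?thesis by auto
qed

lemma \<phi>_nonneg: "0 \<le> \<phi> t"
  unfolding \<phi>_def by (intro real_of_ereal_pos F_nonneg)

lemma regular_le:
  assumes "regular s" "0 < t"
  shows "\<phi> s + \<xi> s \<bullet> (u t - u s) \<le> \<phi> t"
  using subgradient[OF assms(1) u_in_H[OF assms(2)]] F_eq_\<phi>[OF F_finite[OF assms(2)]] by simp

lemma \<phi>_lipschitz_regular:
  assumes "regular s" "0 < s" "0 < t"
  shows "\<bar>\<phi> t - \<phi> s\<bar> \<le> L * \<bar>t - s\<bar>"
proof -
  have "\<phi> t \<le> \<phi> s + L * \<bar>t - s\<bar>"
  proof (rule field_le_epsilon)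
    fix e :: real assume "0 < e"
    define d where "d = e / (L + 1)"
    have "0 < d" using \<open>0 < e\<close> L_nonneg by (simp add: d_def)
    have "L * d \<le> (L + 1) * d" using \<open>0 < d\<close> by (intro mult_right_mono) auto
    also have "\<dots> = e" using L_nonneg by (simp add: d_def)
    finally have "L * d \<le> e" .
    then show "\<phi> t \<le> \<phi> s + L * \<bar>t - s\<bar> + e"
      using F_upper[OF assms \<open>0 < d\<close>] F_eq_\<phi>[OF F_finite[OF assms(3)]]
      by (simp add: distrib_left)
  qed
  then show ?thesis
    using regular_le[OF assms(1,3)] \<xi>_increment[OF assms(2,3), of s] by (simp add: abs_le_iff)
qed

text \<open>
  A regular time between \<open>s\<close> and \<open>t\<close> splits the interval, so the constant \<open>L\<close> is not lost.
\<close>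

lemma \<phi>_lipschitz:
  assumes "0 < s" "s < t"
  shows "\<bar>\<phi> t - \<phi> s\<bar> \<le> L * (t - s)"
proof -
  obtain r where r: "s < r" "r < t" "regular r"
    by (rule regular_between[of s t]) (use assms in auto)
  then have "\<bar>\<phi> t - \<phi> r\<bar> \<le> L * (t - r)" "\<bar>\<phi> s - \<phi> r\<bar> \<le> L * (r - s)"
    using \<phi>_lipschitz_regular[of r t] \<phi>_lipschitz_regular[of r s] assms by auto
  then show ?thesis by (simp add: algebra_simps abs_le_iff)
qed

lemma \<phi>_cont: "continuous_on {0<..} \<phi>"
proof (rule lipschitz_on_continuous_on[of L])
  have "\<bar>\<phi> t - \<phi> s\<bar> \<le> L * \<bar>t - s\<bar>" if "0 < s" "0 < t" for s t
    using \<phi>_lipschitz[of s t] \<phi>_lipschitz[of t s] that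
    by (cases s t rule: linorder_cases) (auto simp: abs_minus_commute)
  then show "L-lipschitz_on {0<..} \<phi>"
    by (intro lipschitz_onI L_nonneg) (auto simp: dist_real_def)
qed

lemma \<phi>_int: "0 < a \<Longrightarrow> set_integrable lebesgue {a..b} \<phi>"
  by (intro set_integrable_continuous continuous_on_subset[OF \<phi>_cont]) auto

text \<open>
  The second derivative is bounded, so backward difference quotients of \<open>u\<close> converge to \<open>u'\<close>
  uniformly in time.
\<close>

lemma u_taylor:
  assumes "0 < h" "h < r"
  shows "norm (u r - u (r - h) - h *\<^sub>R u' r) \<le> C * h\<^sup>2"
proof -
  have i: "set_integrable lebesgue {r - h..r} u'" "set_integrable lebesgue {r - h..r} (\<lambda>t. u' r)"
    by (rule set_integrable_bounded[OF u'_meas u'_bound])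
      (rule set_integrable_continuous[OF continuous_on_const])
  have "(LINT t:{r - h..r}|lebesgue. u' r) = h *\<^sub>R u' r"
    using assms by (simp add: set_lebesgue_integral_def)
  then have "u r - u (r - h) - h *\<^sub>R u' r = (LINT t:{r - h..r}|lebesgue. u' t - u' r)"
    using set_integral_diff(2)[OF i] u_int[of "r - h" r] assms by simp
  also have "norm \<dots> \<le> (C * h) * (r - (r - h))"
  proof (rule norm_LINT_Icc_le)
    show "set_integrable lebesgue {r - h..r} (\<lambda>t. u' t - u' r)"
      by (rule set_integral_diff(1)[OF i])
    fix t assume t: "r - h \<le> t" "t \<le> r"
    have "norm (u' t - u' r) \<le> C * (r - t)"
      using u'_lipschitz[of t r] t assms by (simp add: norm_minus_commute)
    also have "\<dots> \<le> C * h" using t C_nonneg by (intro mult_left_mono) auto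
    finally show "norm (u' t - u' r) \<le> C * h" .
  qed (use assms in simp)
  finally show ?thesis by (simp add: power2_eq_square mult.assoc)
qed

text \<open>
  The half of the chain rule for \<open>F\<close> along the curve that energy dissipation needs. At a regular time
  the subgradient inequality bounds \<open>\<phi> r - \<phi> (r - h)\<close> above by \<open>\<xi> r \<bullet> (u r - u (r - h))\<close>, which is
  \<open>h * (\<xi> r \<bullet> u' r)\<close> up to \<open>L * h\<^sup>2\<close>. Integrating over \<open>r\<close> before \<open>h\<close> tends to \<open>0\<close> avoids
  differentiating \<open>\<phi>\<close> itself: with a primitive \<open>G\<close> of the continuous function \<open>\<phi>\<close>, the left-hand
  side becomes a difference of difference quotients of \<open>G\<close> at \<open>t\<close> and \<open>s\<close>.
\<close>

lemma \<phi>_chain: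
  assumes "0 < s" "s \<le> t"
  shows "\<phi> t - \<phi> s \<le> (LINT r:{s..t}|lebesgue. \<xi> r \<bullet> u' r)"
proof -
  define J where "J = (LINT r:{s..t}|lebesgue. \<xi> r \<bullet> u' r)"
  have J_int: "set_integrable lebesgue {s..t} (\<lambda>r. \<xi> r \<bullet> u' r)"
    by (rule set_integrable_inner[OF \<xi>_meas u'_meas \<xi>_bound u'_bound])
  obtain G where "\<forall>x. ereal 0 < ereal x \<longrightarrow> ereal x < \<infinity> \<longrightarrow> (G has_vector_derivative \<phi> x) (at x)"
    using einterval_antiderivative[of "ereal 0" \<infinity> \<phi>] \<phi>_cont
    by (auto simp: continuous_on_eq_continuous_at)
  then have G: "(G has_real_derivative \<phi> x) (at x)" if "0 < x" for x
    using that by (simp add: has_real_derivative_iff_has_vector_derivative)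
  have step: "(G (t + - h) - G t) / (- h) - (G (s + - h) - G s) / (- h) \<le> J + L * (t - s) * h"
    if h: "0 < h" "h < s" for h
  proof -
    have i1: "set_integrable lebesgue {s..t} \<phi>" using \<phi>_int assms by blast
    have c2: "continuous_on {s..t} (\<lambda>r. \<phi> (r - h))"
      using h by (intro continuous_on_compose2[OF \<phi>_cont] continuous_intros) auto
    note i2 = set_integrable_continuous[OF c2]
    have i3: "set_integrable lebesgue {s..t} (\<lambda>r. h * (\<xi> r \<bullet> u' r) + L * h\<^sup>2)"
      by (intro set_integral_add(1) set_integrable_mult_right J_int
          set_integrable_continuous[OF continuous_on_const])
    have const: "(LINT r:{s..t}|lebesgue. L * h\<^sup>2) = (t - s) * (L * h\<^sup>2)"
      using assms by (simp add: set_lebesgue_integral_def)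
    have "(LINT r:{s..t}|lebesgue. \<phi> r) = G t - G s"
      by (rule LINT_Icc_FTC[OF assms(2)])
        (use assms in \<open>auto intro!: G continuous_on_subset[OF \<phi>_cont]\<close>)
    moreover have "(LINT r:{s..t}|lebesgue. \<phi> (r - h)) = G (t - h) - G (s - h)"
    proof (rule LINT_Icc_FTC[OF assms(2) _ c2])
      fix x assume "s \<le> x"
      then have "0 < x - h" using h by simp
      moreover have "((\<lambda>x. x - h) has_real_derivative 1) (at x)"
        by (auto intro!: derivative_eq_intros)
      ultimately have "((\<lambda>x. G (x - h)) has_real_derivative \<phi> (x - h) * 1) (at x)"
        by (intro DERIV_chain2[where f=G and g="\<lambda>x. x - h"] G)
      then show "((\<lambda>x. G (x - h)) has_real_derivative \<phi> (x - h)) (at x)" by simp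
    qed
    moreover have "(LINT r:{s..t}|lebesgue. \<phi> r) - (LINT r:{s..t}|lebesgue. \<phi> (r - h)) =
        (LINT r:{s..t}|lebesgue. \<phi> r - \<phi> (r - h))"
      by (rule set_integral_diff(2)[OF i1 i2, symmetric])
    moreover have "\<dots> \<le> (LINT r:{s..t}|lebesgue. h * (\<xi> r \<bullet> u' r) + L * h\<^sup>2)"
    proof (rule set_integral_mono_AE[OF set_integral_diff(1)[OF i1 i2] i3])
      show "AE r\<in>{s..t} in lebesgue. \<phi> r - \<phi> (r - h) \<le> h * (\<xi> r \<bullet> u' r) + L * h\<^sup>2"
        using AE_regular
      proof eventually_elim
        case (elim r)
        show ?case
        proof
          assume r: "r \<in> {s..t}"
          then have "regular r" using elim assms by simp
          then have "\<phi> r - \<phi> (r - h) \<le> \<xi> r \<bullet> (u r - u (r - h))"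
            using regular_le[of r "r - h"] r h by (simp add: inner_diff_right)
          also have "\<dots> = h * (\<xi> r \<bullet> u' r) + \<xi> r \<bullet> (u r - u (r - h) - h *\<^sub>R u' r)"
            by (simp add: inner_diff_right)
          also have "\<xi> r \<bullet> (u r - u (r - h) - h *\<^sub>R u' r) \<le>
              norm (\<xi> r) * norm (u r - u (r - h) - h *\<^sub>R u' r)"
            by (rule norm_cauchy_schwarz)
          also have "\<dots> \<le> ((1 + \<eta>) * C) * (C * h\<^sup>2)"
            using r h damping C_nonneg by (intro mult_mono \<xi>_bound u_taylor) auto
          finally show "\<phi> r - \<phi> (r - h) \<le> h * (\<xi> r \<bullet> u' r) + L * h\<^sup>2"
            by (simp add: L_def mult.assoc)
        qed
      qed
    qed
    moreover have "(LINT r:{s..t}|lebesgue. h * (\<xi> r \<bullet> u' r) + L * h\<^sup>2) = h * J + (t - s) * (L * h\<^sup>2)"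
      by (subst set_integral_add(2)[OF set_integrable_mult_right[OF J_int]
            set_integrable_continuous[OF continuous_on_const]]) (unfold const, simp only: J_def set_integral_mult_right)
    ultimately have "(G t - G s) - (G (t - h) - G (s - h)) \<le> (J + L * (t - s) * h) * h"
      by (simp add: algebra_simps power2_eq_square)
    then have "((G t - G s) - (G (t - h) - G (s - h))) / h \<le> J + L * (t - s) * h"
      using h by (simp add: divide_le_eq)
    then show ?thesis by (simp add: diff_divide_distrib)
  qed
  have quot: "((\<lambda>h. (G (x + - h) - G x) / (- h)) \<longlongrightarrow> \<phi> x) (at_right 0)" if "0 < x" for x
  proof -
    have "((\<lambda>h. (G (x + h) - G x) / h) \<longlongrightarrow> \<phi> x) (at_left 0)"
      using G[OF that] by (auto simp: DERIV_def intro: filterlim_at_split[THEN iffD1, THEN conjunct1])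
    then show ?thesis
      unfolding at_left_minus by (simp add: filterlim_filtermap)
  qed
  have "\<phi> t - \<phi> s \<le> J"
  proof (rule tendsto_le[OF _ _ tendsto_diff[OF quot quot]])
    show "((\<lambda>h. J + L * (t - s) * h) \<longlongrightarrow> J) (at_right 0)"
      by (auto intro!: tendsto_eq_intros)
    show "\<forall>\<^sub>F h in at_right 0. (G (t + - h) - G t) / (- h) - (G (s + - h) - G s) / (- h) \<le> J + L * (t - s) * h"
      using eventually_at_right_less eventually_at_right_real[OF assms(1)]
      by eventually_elim (rule step, auto)
  qed (use assms in auto)
  then show ?thesis by (simp add: J_def)
qed

definition E :: "real \<Rightarrow> real"
  where "E t = (u' t \<bullet> u' t) / 2 + \<phi> t"

lemma E_nonneg: "0 \<le> E t"
  using \<phi>_nonneg[of t] by (simp add: E_def)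

text \<open>
  The chain rule for \<open>\<phi>\<close> and the product rule for \<open>u' \<bullet> u'\<close> add up to the integral of
  \<open>(\<xi> + u'') \<bullet> u'\<close>, and \<open>\<xi> + u'' = - \<eta> *\<^sub>R u'\<close>.
\<close>

lemma E_dissipation:
  assumes "0 < s" "s \<le> t"
  shows "E t + \<eta> * (LINT r:{s..t}|lebesgue. u' r \<bullet> u' r) \<le> E s"
proof -
  have i: "set_integrable lebesgue {s..t} (\<lambda>r. u'' r \<bullet> u' r)"
      "set_integrable lebesgue {s..t} (\<lambda>r. u' r \<bullet> u' r)"
    by (rule set_integrable_inner[OF u''_meas u'_meas u''_bound u'_bound]
        set_integrable_inner[OF u'_meas u'_meas u'_bound u'_bound])+
  have "u' t \<bullet> u' t - u' s \<bullet> u' s = (LINT r:{s..t}|lebesgue. u'' r \<bullet> u' r + u' r \<bullet> u'' r)"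
    by (rule inner_product_rule[OF u'_cont u'_cont u''_meas u''_meas u'_bound u'_bound
          u''_bound u''_bound u'_int u'_int assms])
  also have "\<dots> = 2 * (LINT r:{s..t}|lebesgue. u'' r \<bullet> u' r)"
    by (simp add: inner_commute mult_2[symmetric])
  finally have 1: "u' t \<bullet> u' t - u' s \<bullet> u' s = 2 * (LINT r:{s..t}|lebesgue. u'' r \<bullet> u' r)" .
  have "(LINT r:{s..t}|lebesgue. \<xi> r \<bullet> u' r) =
      (LINT r:{s..t}|lebesgue. (- 1) * (u'' r \<bullet> u' r) - \<eta> * (u' r \<bullet> u' r))"
    by (simp add: \<xi>_def inner_diff_left)
  also have "\<dots> = - (LINT r:{s..t}|lebesgue. u'' r \<bullet> u' r) - \<eta> * (LINT r:{s..t}|lebesgue. u' r \<bullet> u' r)"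
    unfolding set_integral_diff(2)[OF set_integrable_mult_right[OF i(1)] set_integrable_mult_right[OF i(2)]]
      set_integral_mult_right by simp
  finally show ?thesis using \<phi>_chain[OF assms] 1 by (simp add: E_def)
qed

lemma E_antimono: "0 < s \<Longrightarrow> s \<le> t \<Longrightarrow> E t \<le> E s"
proof -
  assume st: "0 < s" "s \<le> t"
  have "0 \<le> (LINT r:{s..t}|lebesgue. u' r \<bullet> u' r)"
    unfolding set_lebesgue_integral_def by (intro Bochner_Integration.integral_nonneg) simp
  then have "0 \<le> \<eta> * (LINT r:{s..t}|lebesgue. u' r \<bullet> u' r)" using damping by simp
  with E_dissipation[OF st] show ?thesis by simp
qed

text \<open>
  Testing the equation with \<open>u\<close>: the subgradient inequality at the minimiser \<open>0\<close> gives
  \<open>\<phi> \<le> \<xi> \<bullet> u = - u'' \<bullet> u - \<eta> * (u' \<bullet> u)\<close>. The two product rules for \<open>u \<bullet> u'\<close> and \<open>u \<bullet> u\<close>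
  turn the integral of the right-hand side into that of \<open>u' \<bullet> u'\<close> plus boundary terms, which are
  bounded because \<open>u\<close> and \<open>u'\<close> are.
\<close>

lemma \<phi>_integral_le:
  assumes "0 < s" "s \<le> t"
  shows "(LINT r:{s..t}|lebesgue. \<phi> r) \<le>
    (LINT r:{s..t}|lebesgue. u' r \<bullet> u' r) + (2 + \<eta>) * C\<^sup>2"
proof -
  have i1: "set_integrable lebesgue {s..t} (\<lambda>r. u' r \<bullet> u' r)"
    and i2: "set_integrable lebesgue {s..t} (\<lambda>r. u r \<bullet> u'' r)"
    and i3: "set_integrable lebesgue {s..t} (\<lambda>r. u' r \<bullet> u r)"
    by (rule set_integrable_inner[OF u_meas u''_meas u_bound u''_bound]
        set_integrable_inner[OF u'_meas u'_meas u'_bound u'_bound]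
        set_integrable_inner[OF u'_meas u_meas u'_bound u_bound])+
  have "u t \<bullet> u' t - u s \<bullet> u' s = (LINT r:{s..t}|lebesgue. u' r \<bullet> u' r + u r \<bullet> u'' r)"
    by (rule inner_product_rule[OF u_cont u'_cont u'_meas u''_meas u_bound u'_bound
          u'_bound u''_bound u_int u'_int assms])
  also have "\<dots> = (LINT r:{s..t}|lebesgue. u' r \<bullet> u' r) + (LINT r:{s..t}|lebesgue. u r \<bullet> u'' r)"
    by (rule set_integral_add(2)[OF i1 i2])
  finally have 1: "u t \<bullet> u' t - u s \<bullet> u' s =
    (LINT r:{s..t}|lebesgue. u' r \<bullet> u' r) + (LINT r:{s..t}|lebesgue. u r \<bullet> u'' r)" .
  have "u t \<bullet> u t - u s \<bullet> u s = (LINT r:{s..t}|lebesgue. u' r \<bullet> u r + u r \<bullet> u' r)"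
    by (rule inner_product_rule[OF u_cont u_cont u'_meas u'_meas u_bound u_bound
          u'_bound u'_bound u_int u_int assms])
  also have "\<dots> = 2 * (LINT r:{s..t}|lebesgue. u' r \<bullet> u r)"
    by (simp add: inner_commute mult_2[symmetric])
  finally have 2: "u t \<bullet> u t - u s \<bullet> u s = 2 * (LINT r:{s..t}|lebesgue. u' r \<bullet> u r)" .
  have inner_le: "\<bar>x \<bullet> y\<bar> \<le> C\<^sup>2" if "norm x \<le> C" "norm y \<le> C" for x y :: 'h
    using Cauchy_Schwarz_ineq2[of x y] mult_mono'[OF that norm_ge_zero norm_ge_zero]
    unfolding power2_eq_square by linarith
  have "(LINT r:{s..t}|lebesgue. \<phi> r) \<le> (LINT r:{s..t}|lebesgue. (- 1) * (u r \<bullet> u'' r) - \<eta> * (u' r \<bullet> u r))"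
  proof (rule set_integral_mono_AE)
    show "set_integrable lebesgue {s..t} \<phi>" using \<phi>_int assms by blast
    show "set_integrable lebesgue {s..t} (\<lambda>r. (- 1) * (u r \<bullet> u'' r) - \<eta> * (u' r \<bullet> u r))"
      by (intro set_integral_diff(1) set_integrable_mult_right i2 i3)
    show "AE r\<in>{s..t} in lebesgue. \<phi> r \<le> (- 1) * (u r \<bullet> u'' r) - \<eta> * (u' r \<bullet> u r)"
      using AE_regular
    proof eventually_elim
      case (elim r)
      show ?case
      proof
        assume "r \<in> {s..t}"
        with elim assms have "regular r" by simp
        from subgradient[OF this zero_in_H] have "\<phi> r - \<xi> r \<bullet> u r \<le> 0"
          by (simp add: F_zero zero_ereal_def)
        then show "\<phi> r \<le> (- 1) * (u r \<bullet> u'' r) - \<eta> * (u' r \<bullet> u r)"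
            by (simp add: \<xi>_def inner_diff_left inner_commute[of "u r"])
      qed
    qed
  qed
  also have "\<dots> = - (LINT r:{s..t}|lebesgue. u r \<bullet> u'' r) - \<eta> * (LINT r:{s..t}|lebesgue. u' r \<bullet> u r)"
    unfolding set_integral_diff(2)[OF set_integrable_mult_right[OF i2] set_integrable_mult_right[OF i3]]
      set_integral_mult_right by simp
  also have "\<dots> = (LINT r:{s..t}|lebesgue. u' r \<bullet> u' r) - (u t \<bullet> u' t - u s \<bullet> u' s)
      - \<eta> * ((u t \<bullet> u t - u s \<bullet> u s) / 2)"
    using 1 2 by simp
  also have "\<dots> \<le> (LINT r:{s..t}|lebesgue. u' r \<bullet> u' r) + 2 * C\<^sup>2 + \<eta> * C\<^sup>2"
  proof -
    have "\<bar>u t \<bullet> u' t\<bar> \<le> C\<^sup>2" "\<bar>u s \<bullet> u' s\<bar> \<le> C\<^sup>2" "\<bar>u t \<bullet> u t\<bar> \<le> C\<^sup>2" "\<bar>u s \<bullet> u s\<bar> \<le> C\<^sup>2"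
      by (intro inner_le u_bound u'_bound)+
    moreover from this have "- ((u t \<bullet> u t - u s \<bullet> u s) / 2) \<le> C\<^sup>2"
      using inner_ge_zero[of "u t"] zero_le_power2[of C] abs_le_D1[of "u s \<bullet> u s"] by argo
    then have "\<eta> * (- ((u t \<bullet> u t - u s \<bullet> u s) / 2)) \<le> \<eta> * C\<^sup>2"
      using damping by (intro mult_left_mono) auto
    ultimately show ?thesis by simp
  qed
  finally show ?thesis by (simp add: algebra_simps)
qed

text \<open>
  Dissipation makes \<open>u' \<bullet> u'\<close> integrable over \<open>[1, \<infinity>)\<close>, hence so are \<open>\<phi>\<close> and the decreasing
  energy \<open>E\<close>, which dominates \<open>\<phi>\<close>.
\<close>

theorem energy_decay:
  shows "0 < t \<Longrightarrow> F (u t) < \<infinity>" and "(\<lambda>t. real_of_ereal (F (u t))) \<in> o[at_top](\<lambda>t. 1 / t)"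
proof -
  show "0 < t \<Longrightarrow> F (u t) < \<infinity>" by (rule F_finite)
  have E_int: "set_integrable lebesgue {1..b} E" for b
    unfolding E_def[abs_def]
    by (intro set_integral_add(1) set_integrable_divide \<phi>_int
        set_integrable_inner[OF u'_meas u'_meas u'_bound u'_bound]) auto
  have "E \<in> o[at_top](\<lambda>t. 1 / t)"
  proof (rule antimono_integral_bounded_smallo[OF E_antimono E_nonneg E_int])
    fix t :: real assume t: "1 \<le> t"
    define D where "D = (LINT r:{1..t}|lebesgue. u' r \<bullet> u' r)"
    have "\<eta> * D \<le> E 1"
      using E_dissipation[of 1 t] E_nonneg[of t] t by (simp add: D_def)
    then have D: "D \<le> E 1 / \<eta>" using damping by (simp add: field_simps)
    have "(LINT r:{1..t}|lebesgue. E r) = D / 2 + (LINT r:{1..t}|lebesgue. \<phi> r)"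
      unfolding E_def[abs_def] D_def
      by (subst set_integral_add(2))
        (auto intro!: set_integrable_divide \<phi>_int
          set_integrable_inner[OF u'_meas u'_meas u'_bound u'_bound])
    also have "\<dots> \<le> D / 2 + (D + (2 + \<eta>) * C\<^sup>2)"
      using \<phi>_integral_le[of 1 t] t by (simp add: D_def)
    also have "\<dots> \<le> 3 / 2 * (E 1 / \<eta>) + (2 + \<eta>) * C\<^sup>2" using D by simp
    finally show "(LINT r:{1..t}|lebesgue. E r) \<le> 3 / 2 * (E 1 / \<eta>) + (2 + \<eta>) * C\<^sup>2" .
  qed auto
  moreover have "(\<lambda>t. real_of_ereal (F (u t))) \<in> O[at_top](E)"
  proof (rule landau_o.bigI[of 1])
    show "\<forall>\<^sub>F t in at_top. norm (real_of_ereal (F (u t))) \<le> 1 * norm (E t)"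
    proof (intro always_eventually allI)
      fix t
      have "norm (real_of_ereal (F (u t))) = \<phi> t"
        using \<phi>_nonneg[of t] unfolding \<phi>_def real_norm_def by (rule abs_of_nonneg)
      then show "norm (real_of_ereal (F (u t))) \<le> 1 * norm (E t)"
        using E_nonneg[of t] by (simp add: E_def)
    qed
  qed simp
  ultimately show "(\<lambda>t. real_of_ereal (F (u t))) \<in> o[at_top](\<lambda>t. 1 / t)"
    using landau_o.big_small_trans by blast
qed

end

section \<open>Total variation on the space of square integrable functions\<close>

text \<open>
  Vanishing off \<open>\<Omega>\<close> is orthogonality to the restrictions \<open>w v\<close> of all functions to the complement:
  testing \<open>u\<close> with its own restriction gives the squared norm of \<open>u\<close> off \<open>\<Omega>\<close>.
\<close>

lemma closed_L2_on:
  fixes \<Omega> :: "'a::euclidean_space set"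
  assumes "\<Omega> \<in> sets lebesgue"
  shows "closed (L2_on \<Omega>)"
proof -
  have sq: "square_integrable (\<lambda>x. indicator (- \<Omega>) x * rep_L2 v x)" for v :: "'a L2"
  proof -
    have m: "rep_L2 v \<in> borel_measurable lebesgue" and i: "integrable lebesgue (\<lambda>x. (rep_L2 v x)\<^sup>2)"
      using rep_L2_square_integrable[of v] by (auto simp: square_integrable_def)
    have "integrable lebesgue (\<lambda>x. indicator (- \<Omega>) x *\<^sub>R (rep_L2 v x)\<^sup>2)"
      using assms by (intro integrable_mult_indicator i) (simp add: Compl_in_sets_lebesgue)
    moreover have "(\<lambda>x. (indicator (- \<Omega>) x * rep_L2 v x)\<^sup>2) = (\<lambda>x. indicator (- \<Omega>) x *\<^sub>R (rep_L2 v x)\<^sup>2)"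
      by (auto simp: indicator_def)
    moreover have "(\<lambda>x. indicator (- \<Omega>) x * rep_L2 v x) \<in> borel_measurable lebesgue"
      using assms by (intro borel_measurable_times borel_measurable_indicator m) (simp add: Compl_in_sets_lebesgue)
    ultimately show ?thesis by (simp add: square_integrable_def)
  qed
  define w :: "'a L2 \<Rightarrow> 'a L2" where "w v = abs_L2 (\<lambda>x. indicator (- \<Omega>) x * rep_L2 v x)" for v
  have inner_w: "u \<bullet> w v = (LINT x|lebesgue. rep_L2 u x * (indicator (- \<Omega>) x * rep_L2 v x))" for u v
    using inner_L2.abs_eq[of "rep_L2 u" "\<lambda>x. indicator (- \<Omega>) x * rep_L2 v x"]
      rep_L2_square_integrable[of u] sq[of v] by (simp add: w_def)
  have "L2_on \<Omega> = (\<Inter>v. {u. u \<bullet> w v = 0})"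
  proof (intro equalityI subsetI)
    fix u assume u: "u \<in> L2_on \<Omega>"
    have "u \<bullet> w v = 0" for v
      unfolding inner_w
      by (rule integral_eq_zero_AE) (use u in \<open>auto simp: L2_on_def indicator_def elim: eventually_mono\<close>)
    then show "u \<in> (\<Inter>v. {u. u \<bullet> w v = 0})" by auto
  next
    fix u assume "u \<in> (\<Inter>v. {u. u \<bullet> w v = 0})"
    then have "(LINT x|lebesgue. rep_L2 u x * (indicator (- \<Omega>) x * rep_L2 u x)) = 0"
      using inner_w[of u u] by simp
    then have "AE x in lebesgue. rep_L2 u x * (indicator (- \<Omega>) x * rep_L2 u x) = 0"
      using integral_nonneg_eq_0_iff_AE[OF square_integrable_mult[OF rep_L2_square_integrable sq], of u u]
      by (simp add: indicator_def)
    then show "u \<in> L2_on \<Omega>"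
      by (auto simp: L2_on_def indicator_def elim: eventually_mono)
  qed
  moreover have "closed {u. u \<bullet> w v = 0}" for v
    by (intro closed_Collect_eq continuous_intros)
  ultimately show ?thesis by auto
qed

lemma rep_L2_zero: "AE x in lebesgue. rep_L2 (0 :: 'a::euclidean_space L2) x = 0"
  using rep_abs_L2[OF square_integrable_zero] by (simp add: zero_L2.abs_eq)

lemma zero_in_L2_on: "0 \<in> L2_on \<Omega>"
  using rep_L2_zero by (auto simp: L2_on_def elim: eventually_mono)

lemma square_integrable_bounded_support:
  fixes g :: "'a::euclidean_space \<Rightarrow> real"
  assumes "bounded \<Omega>" "\<Omega> \<in> sets lebesgue" and g: "continuous_on UNIV g"
  shows "square_integrable (\<lambda>x. indicator \<Omega> x * g x)"
  unfolding square_integrable_def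
proof
  have gm: "g \<in> borel_measurable lebesgue"
    using borel_measurable_continuous_onI[OF g] by (auto intro: measurable_completion)
  show m: "(\<lambda>x. indicator \<Omega> x * g x) \<in> borel_measurable lebesgue"
    by (intro borel_measurable_times borel_measurable_indicator gm assms)
  have "compact (closure \<Omega>)" using assms(1) by simp
  then have "bounded (g ` closure \<Omega>)"
    by (intro compact_imp_bounded compact_continuous_image continuous_on_subset[OF g]) auto
  then obtain M where M: "\<forall>y\<in>g ` closure \<Omega>. norm y \<le> M" unfolding bounded_iff ..
  have "\<Omega> \<in> lmeasurable" using assms(1,2) by (rule bounded_set_imp_lmeasurable)
  then have "integrable lebesgue (\<lambda>x. M\<^sup>2 * indicator \<Omega> x)"
    by (intro integrable_mult_right) (simp add: lmeasurable_iff_integrable)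
  then show "integrable lebesgue (\<lambda>x. (indicator \<Omega> x * g x)\<^sup>2)"
  proof (rule Bochner_Integration.integrable_bound)
    show "(\<lambda>x. (indicator \<Omega> x * g x)\<^sup>2) \<in> borel_measurable lebesgue"
      using m by (intro borel_measurable_power)
    have "\<bar>g x\<bar> \<le> \<bar>M\<bar>" if "x \<in> \<Omega>" for x
      using M that closure_subset[of \<Omega>] by force
    then show "AE x in lebesgue. norm ((indicator \<Omega> x * g x)\<^sup>2) \<le> norm (M\<^sup>2 * indicator \<Omega> x)"
      by (intro AE_I2) (auto simp: indicator_def abs_le_square_iff)
  qed
qed

lemma continuous_divergence:
  fixes v :: "'a::euclidean_space \<Rightarrow> 'a"
  assumes "smooth v"
  shows "continuous_on UNIV (divergence v)"
proof -
  have "C_k (Suc 0) v" using assms by (simp add: smooth_def)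
  then have "continuous_on UNIV (\<lambda>x. frechet_derivative v (at x) b)" if "b \<in> Basis" for b
    using that by simp
  then show ?thesis
    unfolding divergence_def[abs_def] by (intro continuous_on_sum continuous_on_inner continuous_on_const)
qed

abbreviation unit_test_fields :: "'a::euclidean_space set \<Rightarrow> ('a \<Rightarrow> 'a) set"
  where "unit_test_fields \<Omega> \<equiv> {v \<in> test_functions \<Omega>. \<forall>x\<in>\<Omega>. norm (v x) \<le> 1}"

text \<open>
  On a bounded set the total variation is a supremum of continuous linear functionals of \<open>L2\<close>.
  The divergence of a test field is bounded, hence square integrable on \<open>\<Omega>\<close>, so each pairing in
  \<open>variation\<close> is an inner product. Square integrable functions are integrable over \<open>\<Omega>\<close>, so
  membership in \<open>BV\<close> reduces to finiteness of the variation, and the value \<open>\<infinity>\<close> outside \<open>BV\<close> is the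
  supremum as well. Lower semicontinuity follows.
\<close>

lemma TV_eq_SUP_inner:
  fixes \<Omega> :: "'a::euclidean_space set" and u :: "'a L2"
  assumes "bounded \<Omega>" "\<Omega> \<in> sets lebesgue"
  shows "TV \<Omega> u =
    (SUP v\<in>unit_test_fields \<Omega>. ereal (u \<bullet> abs_L2 (\<lambda>x. indicator \<Omega> x * divergence v x)))"
proof -
  let ?S = "SUP v\<in>unit_test_fields \<Omega>. ereal (u \<bullet> abs_L2 (\<lambda>x. indicator \<Omega> x * divergence v x))"
  note rep = rep_L2_square_integrable[of u]
  have "(LINT x:\<Omega>|lebesgue. rep_L2 u x * divergence v x) =
      u \<bullet> abs_L2 (\<lambda>x. indicator \<Omega> x * divergence v x)" if "v \<in> unit_test_fields \<Omega>" for v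
  proof -
    have "continuous_on UNIV (divergence v)"
      using that by (intro continuous_divergence) (simp add: test_functions_def)
    then have "square_integrable (\<lambda>x. indicator \<Omega> x * divergence v x)"
      by (rule square_integrable_bounded_support[OF assms])
    then have "u \<bullet> abs_L2 (\<lambda>x. indicator \<Omega> x * divergence v x) =
        (LINT x|lebesgue. rep_L2 u x * (indicator \<Omega> x * divergence v x))"
      using inner_L2.abs_eq[of "rep_L2 u" "\<lambda>x. indicator \<Omega> x * divergence v x"] rep by simp
    then show ?thesis by (simp add: set_lebesgue_integral_def mult.left_commute)
  qed
  then have variation: "variation \<Omega> (rep_L2 u) = ?S"
    unfolding variation_def by (intro SUP_cong) auto
  have "square_integrable (\<lambda>x. indicator \<Omega> x * (1 :: real))"
    by (intro square_integrable_bounded_support assms continuous_on_const)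
  from square_integrable_mult[OF this rep] have "set_integrable lebesgue \<Omega> (rep_L2 u)"
    by (simp add: set_integrable_def)
  then have "rep_L2 u \<in> BV \<Omega> \<longleftrightarrow> variation \<Omega> (rep_L2 u) < \<infinity>"
    by (cases "variation \<Omega> (rep_L2 u)") (auto simp: BV_def)
  then show ?thesis
    unfolding TV_def variation by (cases ?S) auto
qed

lemma TV_nonneg:
  assumes "bounded \<Omega>" "\<Omega> \<in> sets lebesgue"
  shows "0 \<le> TV \<Omega> u"
proof -
  have C0: "C_k k (\<lambda>x::'a. 0::'a)" for k
  proof (induction k)
    case (Suc k)
    then show ?case by simp
  qed simp
  have zero: "(\<lambda>x::'a. 0::'a) \<in> unit_test_fields \<Omega>"
    using C0 by (auto simp: test_functions_def smooth_def intro!: exI[of _ "{}"])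
  have "divergence (\<lambda>x::'a. 0::'a) = (\<lambda>x. 0)"
    by (simp add: divergence_def[abs_def])
  then have "ereal (u \<bullet> abs_L2 (\<lambda>x. indicator \<Omega> x * divergence (\<lambda>x::'a. 0::'a) x)) = 0"
    by (simp add: zero_L2.abs_eq[symmetric] zero_ereal_def)
  moreover have "ereal (u \<bullet> abs_L2 (\<lambda>x. indicator \<Omega> x * divergence (\<lambda>x::'a. 0::'a) x)) \<le> TV \<Omega> u"
    unfolding TV_eq_SUP_inner[OF assms] using zero by (rule SUP_upper)
  ultimately show ?thesis by (simp add: zero_ereal_def)
qed

lemma TV_zero:
  fixes \<Omega> :: "'a::euclidean_space set"
  assumes "bounded \<Omega>" "\<Omega> \<in> sets lebesgue"
  shows "TV \<Omega> 0 = 0"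
proof (rule antisym)
  show "TV \<Omega> 0 \<le> 0"
    unfolding TV_eq_SUP_inner[OF assms] by (intro SUP_least) (simp add: zero_ereal_def)
qed (rule TV_nonneg[OF assms])

lemma closed_TV_sublevel:
  fixes c :: real
  assumes "bounded \<Omega>" "\<Omega> \<in> sets lebesgue"
  shows "closed {u. TV \<Omega> u \<le> ereal c}"
proof -
  have "{u. TV \<Omega> u \<le> ereal c} =
      (\<Inter>v\<in>unit_test_fields \<Omega>. {u. u \<bullet> abs_L2 (\<lambda>x. indicator \<Omega> x * divergence v x) \<le> c})"
    unfolding TV_eq_SUP_inner[OF assms] by (auto simp: SUP_le_iff)
  then show ?thesis by (auto intro!: closed_INT closed_Collect_le continuous_intros)
qed

section \<open>The damped total variation flow\<close>

lemma weak_time_derivative_cong_AE: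
  fixes f g h :: "real \<Rightarrow> 'h::{banach,second_countable_topology}"
  assumes weak: "weak_time_derivative f g"
    and g: "g \<in> borel_measurable (lebesgue_on {0..})" and h: "h \<in> borel_measurable lebesgue"
    and eq: "AE t in lebesgue. 0 < t \<longrightarrow> g t = h t"
  shows "weak_time_derivative f h"
  unfolding weak_time_derivative_def
proof (intro allI impI)
  fix \<phi> :: "real \<Rightarrow> real" assume \<phi>: "\<phi> \<in> test_functions {0<..}"
  then have "C_k 0 \<phi>" unfolding test_functions_def smooth_def by blast
  then have \<phi>_meas: "\<phi> \<in> borel_measurable lebesgue"
    by (intro measurable_lebesgue_continuous) simp
  have g0: "(\<lambda>t. indicator {0..} t *\<^sub>R g t) \<in> borel_measurable lebesgue"
    using g by (simp add: borel_measurable_restrict_space_iff)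
  have "(\<lambda>t. indicator {0<..} t *\<^sub>R \<phi> t *\<^sub>R (indicator {0..} t *\<^sub>R g t)) \<in> borel_measurable lebesgue"
    by (rule borel_measurable_scaleR[OF borel_measurable_indicator borel_measurable_scaleR[OF \<phi>_meas g0]]) simp
  also have "(\<lambda>t. indicator {0<..} t *\<^sub>R \<phi> t *\<^sub>R (indicator {0..} t *\<^sub>R g t)) =
      (\<lambda>t. indicator {0<..} t *\<^sub>R \<phi> t *\<^sub>R g t)"
    by (auto simp: indicator_def)
  finally have m: "(\<lambda>t. indicator {0<..} t *\<^sub>R \<phi> t *\<^sub>R g t) \<in> borel_measurable lebesgue" .
  have "(LINT t:{0<..}|lebesgue. \<phi> t *\<^sub>R g t) = (LINT t:{0<..}|lebesgue. \<phi> t *\<^sub>R h t)"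
    unfolding set_lebesgue_integral_def
  proof (rule integral_cong_AE[OF m])
    show "(\<lambda>t. indicator {0<..} t *\<^sub>R \<phi> t *\<^sub>R h t) \<in> borel_measurable lebesgue"
      by (intro borel_measurable_scaleR borel_measurable_indicator \<phi>_meas h) simp
    show "AE t in lebesgue. indicator {0<..} t *\<^sub>R \<phi> t *\<^sub>R g t = indicator {0<..} t *\<^sub>R \<phi> t *\<^sub>R h t"
      using eq by eventually_elim (auto simp: indicator_def)
  qed
  then show "(LINT t:{0<..}|lebesgue. deriv \<phi> t *\<^sub>R f t) = - (LINT t:{0<..}|lebesgue. \<phi> t *\<^sub>R h t)"
    using weak \<phi> by (simp add: weak_time_derivative_def)
qed

lemma AE_lebesgue_on_nonneg:
  "(AE t in lebesgue_on {0..}. P t) \<longleftrightarrow> (AE t in lebesgue. 0 \<le> t \<longrightarrow> P t)" for P :: "real \<Rightarrow> bool"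
  by (subst AE_restrict_space_iff) auto

lemma Linf_continuous_bounded:
  fixes f :: "real \<Rightarrow> 'h::{banach,second_countable_topology}"
  assumes "f \<in> Linf_time X" "continuous_on {0..} f"
  obtains C where "\<And>t. 0 \<le> t \<Longrightarrow> norm (f t) \<le> C"
proof -
  obtain C where "AE t in lebesgue. 0 \<le> t \<longrightarrow> norm (f t) \<le> C"
    using assms(1) unfolding Linf_time_def AE_lebesgue_on_nonneg by auto
  then have C: "AE t in lebesgue. 0 < t \<longrightarrow> norm (f t) \<le> C"
    by (rule eventually_mono) auto
  have "f t \<in> cball 0 C" if "0 \<le> t" for t
    by (rule continuous_AE_in_closed[OF assms(2) closed_cball C that zero_less_one]) simp
  then show ?thesis by (intro that) simp
qed

text \<open>
  The classes of the problem are turned into functions with pointwise bounds: \<open>u\<close> and its first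
  derivative are continuous, so their essential bounds hold at all times, and the second derivative
  is set to \<open>0\<close> where it exceeds its essential bound. Negative times receive the values at \<open>0\<close>,
  respectively \<open>0\<close> for the second derivative.
\<close>

lemma weak_solution_imp_flow:
  fixes \<Omega> :: "'a::euclidean_space set"
  assumes \<Omega>: "bounded \<Omega>" "\<Omega> \<in> sets lebesgue" and "\<eta> > 0"
    and sol: "weak_solution \<Omega> \<eta> u\<^sub>0 v\<^sub>0 u"
  obtains C U' U'' where "damped_gradient_flow (L2_on \<Omega>) (TV \<Omega>) \<eta> C (\<lambda>t. u (max 0 t)) U' U''"
proof -
  obtain u' u'' where u: "u \<in> Linf_time (dom_dTV \<Omega>)" "continuous_on {0..} u"
    and u': "u' \<in> Linf_time (L2_on \<Omega>)" "continuous_on {0..} u'"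
    and u'': "u'' \<in> Linf_time (L2_on \<Omega>)"
    and weak: "weak_time_derivative u u'" "weak_time_derivative u' u''"
    and flow: "AE t in lebesgue_on {0..}. \<exists>\<xi>\<in>dTV \<Omega> (u t). u'' t + \<eta> *\<^sub>R u' t + \<xi> = 0"
    using sol unfolding weak_solution_def by blast
  obtain C0 where C0: "\<And>t. 0 \<le> t \<Longrightarrow> norm (u t) \<le> C0" using Linf_continuous_bounded[OF u] by blast
  obtain C1 where C1: "\<And>t. 0 \<le> t \<Longrightarrow> norm (u' t) \<le> C1" using Linf_continuous_bounded[OF u'] by blast
  obtain C2 where C2: "AE t in lebesgue. 0 \<le> t \<longrightarrow> norm (u'' t) \<le> C2"
    using u'' unfolding Linf_time_def AE_lebesgue_on_nonneg by auto
  define C where "C = max 0 (max C0 (max C1 C2))"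
  define v where "v t = indicator {0..} t *\<^sub>R u'' t" for t
  define U'' where "U'' t = (if norm (v t) \<le> C then v t else 0)" for t
  let ?U = "\<lambda>t. u (max 0 t)" and ?U' = "\<lambda>t. u' (max 0 t)"
  have cont: "continuous_on UNIV (\<lambda>t. f (max 0 t))"
    if "continuous_on {0..} f" for f :: "real \<Rightarrow> 'a L2"
    by (rule continuous_on_compose2[OF that]) (auto intro!: continuous_intros)
  have v_meas: "v \<in> borel_measurable lebesgue"
    using u'' unfolding v_def[abs_def] by (simp add: Linf_time_def borel_measurable_restrict_space_iff)
  then have U''_meas: "U'' \<in> borel_measurable lebesgue"
    unfolding U''_def[abs_def] by measurable
  have U''_eq: "AE t in lebesgue. 0 < t \<longrightarrow> u'' t = U'' t"
    using C2 by eventually_elim (auto simp: U''_def v_def C_def)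
  have U''_bound: "norm (U'' t) \<le> C" for t by (simp add: U''_def C_def)
  have U'_bound: "norm (?U' t) \<le> C" for t using C1[of "max 0 t"] by (simp add: C_def)
  have U'_meas: "?U' \<in> borel_measurable lebesgue"
    by (rule measurable_lebesgue_continuous[OF cont[OF u'(2)]])
  have "weak_time_derivative u ?U'"
    by (rule weak_time_derivative_cong_AE[OF weak(1) _ U'_meas]) (use u' in \<open>auto simp: Linf_time_def\<close>)
  note u_int = weak_time_derivative_imp_integral[OF this u(2) U'_meas U'_bound]
  have "weak_time_derivative u' U''"
    by (rule weak_time_derivative_cong_AE[OF weak(2) _ U''_meas U''_eq]) (use u'' in \<open>auto simp: Linf_time_def\<close>)
  note u'_int = weak_time_derivative_imp_integral[OF this u'(2) U''_meas U''_bound]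
  have "damped_gradient_flow (L2_on \<Omega>) (TV \<Omega>) \<eta> C ?U ?U' U''"
  proof
    show "norm (?U t) \<le> C" for t using C0[of "max 0 t"] by (simp add: C_def)
    show "?U b - ?U a = (LINT t:{a..b}|lebesgue. ?U' t)" if "0 < a" "a \<le> b" for a b
      using u_int[OF that] that by simp
    show "?U' b - ?U' a = (LINT t:{a..b}|lebesgue. U'' t)" if "0 < a" "a \<le> b" for a b
      using u'_int[OF that] that by simp
    show "AE t in lebesgue. 0 < t \<longrightarrow> - U'' t - \<eta> *\<^sub>R ?U' t \<in> subdifferential (L2_on \<Omega>) (TV \<Omega>) (?U t)"
      using flow[unfolded AE_lebesgue_on_nonneg] U''_eq
    proof eventually_elim
      case (elim t)
      show ?case
      proof
        assume t: "0 < t"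
        with elim obtain \<xi> where \<xi>: "\<xi> \<in> dTV \<Omega> (u t)" "u'' t + \<eta> *\<^sub>R u' t + \<xi> = 0" by auto
        then have "\<xi> = - u'' t - \<eta> *\<^sub>R u' t"
          by (simp add: add_eq_0_iff)
        with \<xi>(1) elim t show "- U'' t - \<eta> *\<^sub>R ?U' t \<in> subdifferential (L2_on \<Omega>) (TV \<Omega>) (?U t)"
          by (simp add: dTV_def)
      qed
    qed
  qed (fact \<open>\<eta> > 0\<close> TV_nonneg[OF \<Omega>] TV_zero[OF \<Omega>] closed_L2_on[OF \<Omega>(2)] zero_in_L2_on
      closed_TV_sublevel[OF \<Omega>] cont[OF u(2)] cont[OF u'(2)] U''_meas U'_bound U''_bound)+
  then show ?thesis by (rule that)
qed

theorem proposition2p7: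
  fixes \<Omega> :: "(real^'n) set" and \<eta> :: real
    and u\<^sub>0 v\<^sub>0 :: "(real^'n) L2" and u :: "real \<Rightarrow> (real^'n) L2"
  assumes "bounded_lipschitz_domain \<Omega>"
    and "\<eta> > 0"
    and "u\<^sub>0 \<in> dom_dTV \<Omega>"
    and "v\<^sub>0 \<in> dom_dTV \<Omega> \<inter> L2_on \<Omega>"
    and "weak_solution \<Omega> \<eta> u\<^sub>0 v\<^sub>0 u"
  shows "(\<forall>\<^sub>F t in at_top. TV \<Omega> (u t) < \<infinity>) \<and>
    (\<lambda>t. real_of_ereal (TV \<Omega> (u t))) \<in> o[at_top](\<lambda>t. 1 / t)"
proof -
  have \<Omega>: "bounded \<Omega>" "\<Omega> \<in> sets lebesgue"
    using assms(1) by (auto simp: bounded_lipschitz_domain_def)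
  obtain C U' U'' where "damped_gradient_flow (L2_on \<Omega>) (TV \<Omega>) \<eta> C (\<lambda>t. u (max 0 t)) U' U''"
    by (rule weak_solution_imp_flow[OF \<Omega> assms(2,5)])
  then interpret damped_gradient_flow "L2_on \<Omega>" "TV \<Omega>" \<eta> C "\<lambda>t. u (max 0 t)" U' U'' .
  have pos: "\<forall>\<^sub>F t in at_top. (0 :: real) < t" by (rule eventually_gt_at_top)
  have "\<forall>\<^sub>F t in at_top. TV \<Omega> (u t) < \<infinity>"
    using pos
  proof eventually_elim
    case (elim t)
    then show ?case using energy_decay(1)[of t] by simp
  qed
  moreover have "\<forall>\<^sub>F t in at_top. real_of_ereal (TV \<Omega> (u (max 0 t))) = real_of_ereal (TV \<Omega> (u t))"
    using pos by eventually_elim simp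
  then have "(\<lambda>t. real_of_ereal (TV \<Omega> (u t))) \<in> o[at_top](\<lambda>t. 1 / t)"
    by (rule landau_o.small.in_cong[THEN iffD1]) (rule energy_decay(2))
  ultimately show ?thesis by blast
qed

end
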